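(* Partially order the ring of symmetric functions using the $h$-basis. For all integers $n\ge1$ and $j,k\ge0$: (1) the Eulerian quasisymmetric functions $Q_{n,j,k}$ and $Q_{n,j}$ are $h$-positive symmetric functions; (2) the polynomial $\sum_{j=0}^{n-1}Q_{n,j,k}\,t^j$, whenever it is nonzero, is $t$-symmetric and $t$-unimodal with center of symmetry $\frac{n-k}{2}$; (3) the polynomial $\sum_{j=0}^{n-1}Q_{n,j}\,t^j$ is $t$-symmetric and $t$-unimodal with center of symmetry $\frac{n-1}{2}$.
   Context: For $n\ge1$, $\mathfrak S_n$ is the symmetric group on $[n]=\{1,\dots,n\}$, and $\sigma\in\mathfrak S_n$ is written $\sigma_1\cdots\sigma_n$ with $\sigma_i=\sigma(i)$. $\mathrm{EXC}(\sigma)=\{i\in[n-1]:\sigma_i>i\}$, $\mathrm{exc}(\sigma)=|\mathrm{EXC}(\sigma)|$, and $\mathrm{fix}(\sigma)$ is the number of fixed points. Totally order the alphabet $[n]\cup\{\bar1,\dots,\bar n\}$ by $\bar1<\cdots<\bar n<1<\cdots<n$. Let $\bar\sigma$ be the word obtained from $\sigma_1\cdots\sigma_n$ by replacing $\sigma_i$ with $\overline{\sigma_i}$ for each $i\in\mathrm{EXC}(\sigma)$, and let $\mathrm{DEX}(\sigma)$ be the set of $i\in[n-1]$ such that the $i$th letter of $\bar\sigma$ is larger than the $(i+1)$st. For $S\subseteq[n-1]$, $F_{S,n}(\mathbf x)=\sum x_{i_1}\cdots x_{i_n}$, summed over all $i_1\ge\cdots\ge i_n\ge1$ with $i_j>i_{j+1}$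 whenever $j\in S$. Then $Q_{n,j}=\sum F_{\mathrm{DEX}(\sigma),n}$ summed over $\sigma\in\mathfrak S_n$ with $\mathrm{exc}(\sigma)=j$, and $Q_{n,j,k}=\sum F_{\mathrm{DEX}(\sigma),n}$ summed over $\sigma\in\mathfrak S_n$ with $\mathrm{exc}(\sigma)=j$ and $\mathrm{fix}(\sigma)=k$. A symmetric function (over $\mathbb Q$) is $h$-positive if it is a nonnegative linear combination of the $h_\lambda=h_{\lambda_1}\cdots h_{\lambda_\ell}$, $\lambda$ ranging over all partitions, where $h_m$ is the complete homogeneous symmetric function. The $h$-basis partial order is: $f\le_h g$ iff $g-f$ is $h$-positive. Let $R$ be a partially ordered ring and $f(t)=f_rt^r+f_{r+1}t^{r+1}+\cdots+f_st^s$ a nonzero polynomial with coefficients in $R$. Then $f(t)$ is $t$-symmetric with center of symmetry $\frac{s+r}{2}$ if $f_{r+i}=f_{s-i}$ for all $i=0,\dots,s-r$; it is also $t$-unimodal if $f_r\le_R f_{r+1}\le_R\cdots\le_R f_{\lfloor (s+r)/2\rfloor}=f_{\lfloor (s+r+1)/2\rfloor}\ge_R\cdots\ge_R f_{s-1}\ge_R f_s$. *)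

theory Defs
  imports
    "HOL-Library.Multiset"
    "HOL-Combinatorics.Permutations"
    "HOL-Computational_Algebra.Polynomial"
begin

section \<open>Formal power series in countably many variables\<close>

text \<open>
  A monomial is a finite multiset of variable indices. Indices are shifted by one: the natural
  number i stands for the variable with subscript i + 1, so that UNIV indexes exactly the
  variables with positive subscript.
\<close>

typedef 'a mpseries = "UNIV :: (nat multiset \<Rightarrow> 'a) set"
  morphisms mcoeff Abs_mpseries ..

lemma mcoeff_Abs [simp]: "mcoeff (Abs_mpseries f) = f"
  by (simp add: Abs_mpseries_inverse)

lemma mpseries_eqI: "(\<And>M. mcoeff f M = mcoeff g M) \<Longrightarrow> f = g"
  by (metis ext mcoeff_inject)

lemma mpseries_eq_iff: "f = g \<longleftrightarrow> (\<forall>M. mcoeff f M = mcoeff g M)"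
  by (auto intro: mpseries_eqI)

lemma finite_submultisets: "finite {A :: 'b multiset. A \<subseteq># M}"
proof (induction M)
  case (add x M)
  have "{A. A \<subseteq># add_mset x M} \<subseteq> {A. A \<subseteq># M} \<union> add_mset x ` {A. A \<subseteq># M}"
  proof
    fix A assume "A \<in> {A. A \<subseteq># add_mset x M}"
    then have A: "A \<subseteq># add_mset x M" by simp
    show "A \<in> {A. A \<subseteq># M} \<union> add_mset x ` {A. A \<subseteq># M}"
    proof (cases "x \<in># A")
      case True
      then obtain B where "A = add_mset x B" by (blast dest: multi_member_split)
      with A show ?thesis by auto
    next
      case False
      with A have "A \<subseteq># M"
        by (metis count_add_mset le0 not_in_iff subseteq_mset_def)
      then show ?thesis by simp
    qed
  qed
  then show ?case using add by (meson finite_UnI finite_imageI finite_subset)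
qed simp

lemma finite_multiset_splits: "finite {(A, B). A + B = (M :: 'b multiset)}"
proof -
  have "{(A, B). A + B = M} \<subseteq> {A. A \<subseteq># M} \<times> {A. A \<subseteq># M}" by auto
  then show ?thesis
    by (rule finite_subset) (intro finite_cartesian_product finite_submultisets)
qed

instantiation mpseries :: (comm_ring_1) comm_ring_1
begin

definition zero_mpseries :: "'a mpseries" where
  "0 = Abs_mpseries (\<lambda>M. 0)"

definition one_mpseries :: "'a mpseries" where
  "1 = Abs_mpseries (\<lambda>M. if M = {#} then 1 else 0)"

definition plus_mpseries :: "'a mpseries \<Rightarrow> 'a mpseries \<Rightarrow> 'a mpseries" where
  "f + g = Abs_mpseries (\<lambda>M. mcoeff f M + mcoeff g M)"

definition uminus_mpseries :: "'a mpseries \<Rightarrow> 'a mpseries" where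
  "- f = Abs_mpseries (\<lambda>M. - mcoeff f M)"

definition minus_mpseries :: "'a mpseries \<Rightarrow> 'a mpseries \<Rightarrow> 'a mpseries" where
  "f - g = Abs_mpseries (\<lambda>M. mcoeff f M - mcoeff g M)"

definition times_mpseries :: "'a mpseries \<Rightarrow> 'a mpseries \<Rightarrow> 'a mpseries" where
  "f * g = Abs_mpseries (\<lambda>M. \<Sum>(A, B) \<in> {(A, B). A + B = M}. mcoeff f A * mcoeff g B)"

lemma mcoeff_simps:
  "mcoeff 0 M = (0 :: 'a)"
  "mcoeff 1 M = (if M = {#} then 1 else 0 :: 'a)"
  "mcoeff (f + g) M = mcoeff f M + mcoeff g M"
  "mcoeff (- f) M = - mcoeff f M"
  "mcoeff (f - g) M = mcoeff f M - mcoeff g M"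
  "mcoeff (f * g) M = (\<Sum>(A, B) \<in> {(A, B). A + B = M}. mcoeff f A * mcoeff g B)"
  for f g :: "'a mpseries"
  by (simp_all add: zero_mpseries_def one_mpseries_def plus_mpseries_def uminus_mpseries_def
      minus_mpseries_def times_mpseries_def)

instance
proof
  fix a b c :: "'a mpseries"
  show "a + b + c = a + (b + c)" "a + b = b + a" "0 + a = a" "- a + a = 0" "a - b = a + - b"
    by (auto simp: mpseries_eq_iff mcoeff_simps)
  show "(0 :: 'a mpseries) \<noteq> 1"
    by (auto simp: mpseries_eq_iff mcoeff_simps)
  show "a * b = b * a"
  proof (rule mpseries_eqI)
    fix M
    show "mcoeff (a * b) M = mcoeff (b * a) M"
      unfolding mcoeff_simps
      by (rule sum.reindex_bij_witness[where i = prod.swap and j = prod.swap])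
        (auto simp: add.commute mult.commute)
  qed
  show "(a + b) * c = a * c + b * c"
    by (rule mpseries_eqI)
      (simp add: mcoeff_simps distrib_right case_prod_unfold sum.distrib)
  show "1 * a = a"
  proof (rule mpseries_eqI)
    fix M
    have "mcoeff (1 * a) M = (\<Sum>(A, B) \<in> {({#}, M)}. mcoeff 1 A * mcoeff a B)"
      unfolding mcoeff_simps(6)
      by (rule sum.mono_neutral_right)
        (auto simp: finite_multiset_splits mcoeff_simps split: if_splits)
    then show "mcoeff (1 * a) M = mcoeff a M" by (simp add: mcoeff_simps)
  qed
  show "a * b * c = a * (b * c)"
  proof (rule mpseries_eqI)
    fix M
    have "mcoeff (a * b * c) M =
        (\<Sum>(P, C) \<in> {(P, C). P + C = M}. \<Sum>(A, B) \<in> {(A, B). A + B = P}.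
          mcoeff a A * mcoeff b B * mcoeff c C)"
      by (simp add: mcoeff_simps case_prod_unfold sum_distrib_right)
    also have "\<dots> = (\<Sum>((P, C), (A, B)) \<in> (SIGMA (P, C) : {(P, C). P + C = M}. {(A, B). A + B = P}).
          mcoeff a A * mcoeff b B * mcoeff c C)"
      by (subst sum.Sigma[symmetric])
        (auto simp: finite_multiset_splits case_prod_unfold
          intro: finite_multiset_splits[unfolded case_prod_unfold])
    also have "\<dots> = (\<Sum>((A, P), (B, C)) \<in> (SIGMA (A, P) : {(A, P). A + P = M}. {(B, C). B + C = P}).
          mcoeff a A * (mcoeff b B * mcoeff c C))"
      by (rule sum.reindex_bij_witness[where
            j = "\<lambda>((P, C), (A, B)). ((A, B + C), (B, C))" and
            i = "\<lambda>((A, P), (B, C)). ((A + B, C), (A, B))"])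
        (auto simp: algebra_simps)
    also have "\<dots> = (\<Sum>(A, P) \<in> {(A, P). A + P = M}. \<Sum>(B, C) \<in> {(B, C). B + C = P}.
          mcoeff a A * (mcoeff b B * mcoeff c C))"
      by (subst sum.Sigma[symmetric])
        (auto simp: finite_multiset_splits case_prod_unfold
          intro: finite_multiset_splits[unfolded case_prod_unfold])
    also have "\<dots> = mcoeff (a * (b * c)) M"
      by (simp add: mcoeff_simps case_prod_unfold sum_distrib_left)
    finally show "mcoeff (a * b * c) M = mcoeff (a * (b * c)) M" .
  qed
qed

end

definition mscale :: "'a::comm_ring_1 \<Rightarrow> 'a mpseries \<Rightarrow> 'a mpseries" where
  "mscale c f = Abs_mpseries (\<lambda>M. c * mcoeff f M)"


section \<open>Symmetric functions and the h-basis order\<close>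

text \<open>
  Monomials have finite support, so invariance under all bijections of the variables amounts to
  invariance under all finitary permutations.
\<close>

definition symmetric_function :: "'a::comm_ring_1 mpseries \<Rightarrow> bool" where
  "symmetric_function f \<longleftrightarrow>
     (\<forall>\<pi> M. bij \<pi> \<longrightarrow> mcoeff f (image_mset \<pi> M) = mcoeff f M) \<and>
     (\<exists>d. \<forall>M. mcoeff f M \<noteq> 0 \<longrightarrow> size M \<le> d)"

definition complete_h :: "nat \<Rightarrow> rat mpseries" where
  "complete_h m = Abs_mpseries (\<lambda>M. if size M = m then 1 else 0)"

text \<open>An integer partition is the multiset of its (positive) parts.\<close>

definition is_partition :: "nat multiset \<Rightarrow> bool" where
  "is_partition \<mu> \<longleftrightarrow> 0 \<notin># \<mu>"

definition h_prod :: "nat multiset \<Rightarrow> rat mpseries" where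
  "h_prod \<mu> = prod_mset (image_mset complete_h \<mu>)"

definition h_positive :: "rat mpseries \<Rightarrow> bool" where
  "h_positive f \<longleftrightarrow>
     (\<exists>P c. finite P \<and> (\<forall>\<mu>\<in>P. is_partition \<mu> \<and> c \<mu> \<ge> 0) \<and>
        f = (\<Sum>\<mu>\<in>P. mscale (c \<mu>) (h_prod \<mu>)))"

text \<open>The order relation lives on the ring of symmetric functions only.\<close>

definition h_le :: "rat mpseries \<Rightarrow> rat mpseries \<Rightarrow> bool" where
  "h_le f g \<longleftrightarrow> symmetric_function f \<and> symmetric_function g \<and> h_positive (g - f)"


section \<open>Symmetric and unimodal polynomials\<close>

text \<open>
  For a nonzero polynomial f, the bounds r and s are the least and the largest exponent with a
  nonzero coefficient; the latter is degree f.
\<close>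

definition low_degree :: "'a::zero poly \<Rightarrow> nat" where
  "low_degree f = (LEAST i. coeff f i \<noteq> 0)"

definition t_symmetric :: "'a::zero poly \<Rightarrow> bool" where
  "t_symmetric f \<longleftrightarrow> f \<noteq> 0 \<and>
     (let r = low_degree f; s = degree f
      in \<forall>i \<le> s - r. coeff f (r + i) = coeff f (s - i))"

definition center_of_symmetry :: "'a::zero poly \<Rightarrow> rat" where
  "center_of_symmetry f = (of_nat (degree f) + of_nat (low_degree f)) / 2"

definition t_unimodal :: "('a::zero \<Rightarrow> 'a \<Rightarrow> bool) \<Rightarrow> 'a poly \<Rightarrow> bool" where
  "t_unimodal le f \<longleftrightarrow> t_symmetric f \<and>
     (let r = low_degree f; s = degree f
      in (\<forall>i. r \<le> i \<and> i < (s + r) div 2 \<longrightarrow> le (coeff f i) (coeff f (i + 1))) \<and>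
         coeff f ((s + r) div 2) = coeff f ((s + r + 1) div 2) \<and>
         (\<forall>i. (s + r + 1) div 2 \<le> i \<and> i < s \<longrightarrow> le (coeff f (i + 1)) (coeff f i)))"


section \<open>Eulerian quasisymmetric functions\<close>

text \<open>A permutation of [n] is a function that permutes {1..n} (and is the identity elsewhere).\<close>

definition EXC :: "nat \<Rightarrow> (nat \<Rightarrow> nat) \<Rightarrow> nat set" where
  "EXC n \<sigma> = {i \<in> {1..n - 1}. \<sigma> i > i}"

definition exc :: "nat \<Rightarrow> (nat \<Rightarrow> nat) \<Rightarrow> nat" where
  "exc n \<sigma> = card (EXC n \<sigma>)"

definition fixed_points :: "nat \<Rightarrow> (nat \<Rightarrow> nat) \<Rightarrow> nat" where
  "fixed_points n \<sigma> = card {i \<in> {1..n}. \<sigma> i = i}"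

datatype letter = Barred nat | Plain nat

fun letter_less :: "letter \<Rightarrow> letter \<Rightarrow> bool" where
  "letter_less (Barred a) (Barred b) \<longleftrightarrow> a < b"
| "letter_less (Barred a) (Plain b) \<longleftrightarrow> True"
| "letter_less (Plain a) (Barred b) \<longleftrightarrow> False"
| "letter_less (Plain a) (Plain b) \<longleftrightarrow> a < b"

definition bar_letter :: "nat \<Rightarrow> (nat \<Rightarrow> nat) \<Rightarrow> nat \<Rightarrow> letter" where
  "bar_letter n \<sigma> i = (if i \<in> EXC n \<sigma> then Barred (\<sigma> i) else Plain (\<sigma> i))"

definition DEX :: "nat \<Rightarrow> (nat \<Rightarrow> nat) \<Rightarrow> nat set" where
  "DEX n \<sigma> = {i \<in> {1..n - 1}. letter_less (bar_letter n \<sigma> (i + 1)) (bar_letter n \<sigma> i)}"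

text \<open>
  The index sequence of a term of F is a list w of length n, whose entry w ! (j - 1) is the
  j-th index shifted by one. The coefficient of M counts the sequences w yielding the monomial M.
\<close>

definition fundamental_qsym :: "nat set \<Rightarrow> nat \<Rightarrow> rat mpseries" where
  "fundamental_qsym S n = Abs_mpseries (\<lambda>M. of_nat (card
     {w :: nat list. length w = n \<and>
        (\<forall>j \<in> {1..n - 1}. w ! (j - 1) \<ge> w ! j) \<and>
        (\<forall>j \<in> S. w ! (j - 1) > w ! j) \<and>
        mset w = M}))"

definition eulerian_Q :: "nat \<Rightarrow> nat \<Rightarrow> rat mpseries" where
  "eulerian_Q n j = (\<Sum>\<sigma> \<in> {\<sigma>. \<sigma> permutes {1..n} \<and> exc n \<sigma> = j}. fundamental_qsym (DEX n \<sigma>) n)"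

definition eulerian_Q_fix :: "nat \<Rightarrow> nat \<Rightarrow> nat \<Rightarrow> rat mpseries" where
  "eulerian_Q_fix n j k = (\<Sum>\<sigma> \<in> {\<sigma>. \<sigma> permutes {1..n} \<and> exc n \<sigma> = j \<and> fixed_points n \<sigma> = k}.
     fundamental_qsym (DEX n \<sigma>) n)"

definition eulerian_poly :: "nat \<Rightarrow> rat mpseries poly" where
  "eulerian_poly n = (\<Sum>j = 0..n - 1. monom (eulerian_Q n j) j)"

definition eulerian_fix_poly :: "nat \<Rightarrow> nat \<Rightarrow> rat mpseries poly" where
  "eulerian_fix_poly n k = (\<Sum>j = 0..n - 1. monom (eulerian_Q_fix n j k) j)"

end

theory Submission
  imports Defs "HOL-Library.FuncSet"
begin

text \<open>
  Fix a monomial \<open>M\<close> of degree \<open>n\<close> and let \<open>v\<close> be the weakly decreasing word with content \<open>M\<close>. The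
  coefficient of \<open>M\<close> in \<open>F\<^bsub>S,n\<^esub>\<close> is 1 if \<open>v\<close> has a strict descent at every position in \<open>S\<close>, and 0
  otherwise. So the coefficient of \<open>M\<close> in \<open>Q\<^bsub>n,j,k\<^esub>\<close> counts permutations \<open>\<sigma>\<close> such that, on each
  block (maximal constant segment) of \<open>v\<close>, the excedance positions come first and \<open>\<sigma>\<close> increases on
  the excedance positions and on the remaining ones. The proof evaluates this number exactly.

  \<^emph>\<open>From permutations to words.\<close> Write at place \<open>i\<close> the letter \<open>v(\<sigma>\<^sup>-\<^sup>1(i))\<close>, barred if
  \<open>\<sigma>\<^sup>-\<^sup>1(i) < i\<close>. This word has content \<open>M\<close> and determines \<open>\<sigma>\<close>, because \<open>\<sigma>\<^sup>-\<^sup>1\<close> is its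
  standardization. Which words occur is a condition on each place separately: a barred letter must
  be larger than \<open>v(i)\<close>, or equal to it if \<open>i\<close> is not the first place of its block, and an unbarred
  letter must be at most \<open>v(i)\<close>. The fixed points of \<open>\<sigma>\<close> are visible as well: in each block they
  form the trailing run of unbarred letters equal to \<open>v(i)\<close> (\<open>bij_betw_code\<close>). Hence the words with
  prescribed fixed points, counted by \<open>t\<close> to the number of bars, are a coefficient of a product of
  linear forms, one for each place. Splitting off the fixed points gives the number
  \<open>derangement_coeff t (M - A)\<close>, where \<open>A\<close> is the monomial formed by the fixed points
  (\<open>sum_words\<close>). Therefore \<open>\<Sum>\<^sub>j Q\<^bsub>n,j,k\<^esub> t\<^sup>j = h\<^sub>k D\<^bsub>n-k\<^esub>\<close>, where the coefficients of \<open>D\<^sub>m\<close> are those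
  numbers in degree \<open>m\<close>.

  \<^emph>\<open>Evaluation.\<close> Let \<open>C\<^sub>a = t \<Sum>\<^bsub>c\<ge>a\<^esub> x\<^sub>c + \<Sum>\<^bsub>c<a\<^esub> x\<^sub>c\<close> and \<open>L\<^sub>b = C\<^sub>b + x\<^sub>b = C\<^bsub>b+1\<^esub> + t x\<^sub>b\<close>. If a
  fixed point has weight \<open>a\<close>, then a block of \<open>m \<ge> 1\<close> letters \<open>b\<close> contributes
  \<open>C\<^bsub>b+1\<^esub> L\<^sub>b\<^sup>m\<^sup>-\<^sup>1\<close> for \<open>a = 1\<close> and \<open>C\<^sub>b L\<^sub>b\<^sup>m\<^sup>-\<^sup>1\<close> for \<open>a = t\<close>. Restricted to the variables that occur
  in \<open>M\<close>, the form \<open>C\<^bsub>b+1\<^esub>\<close> equals \<open>C\<^bsub>b'\<^esub>\<close> for the next larger variable \<open>b'\<close>, and the form cut below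
  all variables is \<open>t\<close> times the one cut above all of them. So \<open>\<Prod> C\<^sub>b = t \<Prod> C\<^bsub>b+1\<^esub>\<close>, and the two
  weighted counts differ by the factor \<open>t\<close>:
  \<open>\<Sum>\<^bsub>A\<subseteq>M\<^esub> (t\<^sup>|\<^sup>A\<^sup>| - t) derangement_coeff t (M - A) = 0\<close>
  for nonempty \<open>M\<close> (\<open>derangement_coeff_functional_equation\<close>). Dividing by \<open>t - 1\<close> yields
  \<open>D\<^sub>n = \<Sum>\<^bsub>2\<le>i\<le>n\<^esub> (t + \<dots> + t\<^sup>i\<^sup>-\<^sup>1) h\<^sub>i D\<^bsub>n-i\<^esub>\<close>, and summing \<open>h\<^sub>k D\<^bsub>n-k\<^esub>\<close> over \<open>k\<close> yields
  \<open>\<Sum>\<^sub>j Q\<^bsub>n,j\<^esub> t\<^sup>j = \<Sum>\<^bsub>1\<le>i\<le>n\<^esub> (1 + t + \<dots> + t\<^sup>i\<^sup>-\<^sup>1) h\<^sub>i D\<^bsub>n-i\<^esub>\<close>.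

  \<^emph>\<open>Conclusion.\<close> Multiplying a palindromic, \<open>h\<close>-unimodal and \<open>h\<close>-positive polynomial by
  \<open>1 + t + \<dots> + t\<^sup>i\<^sup>-\<^sup>1\<close> preserves these properties and moves the center by \<open>(i - 1)/2\<close>
  (\<open>h_unimodal_pgeom\<close>). By induction \<open>D\<^sub>n\<close> has them with center \<open>n/2\<close>, which gives center
  \<open>(n - k)/2\<close> for \<open>h\<^sub>k D\<^bsub>n-k\<^esub>\<close> and center \<open>(n - 1)/2\<close> for the sum over all \<open>k\<close>.
\<close>

section \<open>Linear forms and monomials\<close>

text \<open>
A linear form in all the variables at once: its coefficients need not have finite support.
\<close>

definition lin_form :: "(nat \<Rightarrow> 'a::comm_ring_1) \<Rightarrow> 'a mpseries" where
  "lin_form f = Abs_mpseries (\<lambda>M. if size M = 1 then f (the_elem (set_mset M)) else 0)"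

definition mono_series :: "nat multiset \<Rightarrow> 'a::comm_ring_1 mpseries" where
  "mono_series A = Abs_mpseries (\<lambda>M. if M = A then 1 else 0)"

abbreviation mvar :: "nat \<Rightarrow> 'a::comm_ring_1 mpseries" where
  "mvar c \<equiv> mono_series {#c#}"

lemma mcoeff_mscale [simp]: "mcoeff (mscale c f) M = c * mcoeff f M"
  by (simp add: mscale_def)

lemma mcoeff_sum: "mcoeff (sum f A) M = (\<Sum>x\<in>A. mcoeff (f x) M)"
  by (induction A rule: infinite_finite_induct) (auto simp: mcoeff_simps)

lemma mscale_1 [simp]: "mscale 1 f = f"
  by (rule mpseries_eqI) simp

lemma mscale_mult: "mscale c f * mscale d g = mscale (c * d) (f * g)"
  by (rule mpseries_eqI)
    (simp only: mcoeff_simps mcoeff_mscale, auto simp: sum_distrib_left mult_ac intro!: sum.cong)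

lemma mscale_mult_left: "mscale c f * g = mscale c (f * g)"
  by (metis mscale_mult mscale_1 mult.right_neutral)

lemma mscale_mult_right: "f * mscale c g = mscale c (f * g)"
  by (metis mscale_mult_left mult.commute)

lemma mscale_mscale [simp]: "mscale c (mscale d f) = mscale (c * d) f"
  by (rule mpseries_eqI) (simp add: mult_ac)

lemma mscale_prod: "(\<Prod>i\<in>I. mscale (a i) (f i)) = mscale (\<Prod>i\<in>I. a i) (\<Prod>i\<in>I. f i)"
  by (induction I rule: infinite_finite_induct) (auto simp: mscale_mult)

lemma mcoeff_mono_mult:
  "mcoeff (mono_series A * f) M = (if A \<subseteq># M then mcoeff f (M - A) else 0)"
proof -
  have "mcoeff (mono_series A * f) M
      = (\<Sum>(P, Q) \<in> (if A \<subseteq># M then {(A, M - A)} else {}). mcoeff (mono_series A) P * mcoeff f Q)"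
    unfolding mcoeff_simps(6)
    by (rule sum.mono_neutral_right)
      (auto simp: finite_multiset_splits mono_series_def split: if_splits)
  then show ?thesis by (simp add: mono_series_def)
qed

lemma mono_series_empty [simp]: "mono_series {#} = 1"
  by (rule mpseries_eqI) (simp add: mono_series_def mcoeff_simps)

lemma mono_series_add: "mono_series (A + B) = mono_series A * mono_series B"
proof (rule mpseries_eqI)
  fix M
  have "M = A + B \<longleftrightarrow> A \<subseteq># M \<and> M - A = B"
    by (metis add_diff_cancel_left' mset_subset_eq_add_left subset_mset.add_diff_inverse)
  then show "mcoeff (mono_series (A + B)) M = mcoeff (mono_series A * mono_series B) M"
    unfolding mcoeff_mono_mult by (simp add: mono_series_def)
qed

lemma mono_series_prod:
  "finite I \<Longrightarrow> (\<Prod>i\<in>I. mono_series (f i)) = mono_series (\<Sum>i\<in>I. f i)"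
  by (induction I rule: finite_induct) (auto simp: mono_series_add)

lemma mono_series_power: "mono_series {#c#} ^ k = mono_series (replicate_mset k c)"
  by (induction k) (simp_all add: mono_series_add[symmetric])

lemma prod_mvar:
  "finite I \<Longrightarrow> (\<Prod>i\<in>I. mvar (c i)) = mono_series (image_mset c (mset_set I))"
  by (induction I rule: finite_induct) (auto simp: mono_series_add[symmetric])

lemma mcoeff_lin_form_single [simp]: "mcoeff (lin_form f) {#c#} = f c"
  by (simp add: lin_form_def)

lemma mcoeff_lin_form_eq_0: "size M \<noteq> 1 \<Longrightarrow> mcoeff (lin_form f) M = 0"
  by (simp add: lin_form_def)

text \<open>
The linear forms below involve all variables, but the coefficient of one monomial depends only on
the variables that divide it. Equality of restrictions to an alphabet replaces the truncation to
finitely many variables.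
\<close>

definition agree_on :: "nat set \<Rightarrow> 'a::comm_ring_1 mpseries \<Rightarrow> 'a mpseries \<Rightarrow> bool" where
  "agree_on B f g \<longleftrightarrow> (\<forall>M. set_mset M \<subseteq> B \<longrightarrow> mcoeff f M = mcoeff g M)"

lemma agree_onD: "agree_on B f g \<Longrightarrow> set_mset M \<subseteq> B \<Longrightarrow> mcoeff f M = mcoeff g M"
  by (simp add: agree_on_def)

lemma agree_on_refl [simp]: "agree_on B f f"
  by (simp add: agree_on_def)

lemma agree_on_sym: "agree_on B f g \<Longrightarrow> agree_on B g f"
  by (simp add: agree_on_def)

lemma agree_on_trans [trans]: "agree_on B f g \<Longrightarrow> agree_on B g h \<Longrightarrow> agree_on B f h"
  by (simp add: agree_on_def)

lemma agree_on_mscale: "agree_on B f g \<Longrightarrow> agree_on B (mscale c f) (mscale c g)"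
  by (simp add: agree_on_def)

lemma agree_on_mult: "agree_on B f g \<Longrightarrow> agree_on B f' g' \<Longrightarrow> agree_on B (f * f') (g * g')"
  by (auto simp: agree_on_def mcoeff_simps intro!: sum.cong)

lemma agree_on_prod:
  "(\<And>i. i \<in> I \<Longrightarrow> agree_on B (f i) (g i)) \<Longrightarrow> agree_on B (\<Prod>i\<in>I. f i) (\<Prod>i\<in>I. g i)"
  by (induction I rule: infinite_finite_induct) (auto intro: agree_on_mult)

lemma size_1_iff: "size M = Suc 0 \<longleftrightarrow> (\<exists>c. M = {#c#})"
  using size_1_singleton_mset by (auto)

lemma agree_on_lin_formI:
  "(\<And>c. c \<in> B \<Longrightarrow> f c = g c) \<Longrightarrow> agree_on B (lin_form f) (lin_form g)"
  unfolding agree_on_def by (auto simp: lin_form_def size_1_iff)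

lemma agree_on_lin_form_sum:
  assumes "finite B"
  shows "agree_on B (lin_form f) (\<Sum>c\<in>B. mscale (f c) (mvar c))"
  unfolding agree_on_def
proof (intro allI impI)
  fix M assume M: "set_mset M \<subseteq> B"
  show "mcoeff (lin_form f) M = mcoeff (\<Sum>c\<in>B. mscale (f c) (mvar c)) M"
  proof (cases "size M = 1")
    case True
    then obtain c where c: "M = {#c#}" by (auto simp: size_1_iff)
    have "mcoeff (\<Sum>c\<in>B. mscale (f c) (mvar c)) M = (\<Sum>d\<in>B. if d = c then f d else 0)"
      unfolding mcoeff_sum by (rule sum.cong) (auto simp: c mono_series_def)
    then show ?thesis using assms M c by simp
  next
    case False
    then have "mcoeff (\<Sum>c\<in>B. mscale (f c) (mvar c)) M = 0"
      unfolding mcoeff_sum by (intro sum.neutral) (auto simp: mono_series_def)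
    with False show ?thesis by (simp add: mcoeff_lin_form_eq_0)
  qed
qed

section \<open>The block polynomials\<close>

text \<open>
In the row of the letter \<open>b\<close>, a larger letter must be barred and has weight \<open>t\<close>, a smaller one must
be unbarred and has weight 1, and \<open>b\<close> itself may be either, with total weight \<open>1 + t\<close>. The row form
without its unbarred \<open>b\<close> is cut at \<open>b\<close>; without its barred \<open>b\<close> it is cut at \<open>Suc b\<close>.
\<close>

definition cut_form :: "'a::comm_ring_1 \<Rightarrow> nat \<Rightarrow> 'a mpseries" where
  "cut_form t a = lin_form (\<lambda>c. if a \<le> c then t else 1)"

definition row_form :: "'a::comm_ring_1 \<Rightarrow> nat \<Rightarrow> 'a mpseries" where
  "row_form t b = cut_form t b + mvar b"

lemma cut_form_Suc: "cut_form t (Suc b) = row_form t b - mscale t (mvar b)"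
  by (rule mpseries_eqI)
    (auto simp: cut_form_def row_form_def lin_form_def mono_series_def mcoeff_simps size_1_iff)

lemma cut_form_eq: "cut_form t b = row_form t b - mvar b"
  by (simp add: row_form_def)

text \<open>
The generating polynomial of a block of \<open>m\<close> places with label \<open>b\<close> that contains no fixed point: the
first place excludes the barred \<open>b\<close> and the last place excludes the unbarred one. For \<open>m = 1\<close> both
restrictions fall on the same place.
\<close>

definition derangement_block :: "'a::comm_ring_1 \<Rightarrow> nat \<Rightarrow> nat \<Rightarrow> 'a mpseries" where
  "derangement_block t b m =
     (if m = 0 then 1 else if m = 1 then cut_form t b - mscale t (mvar b)
      else cut_form t b * cut_form t (Suc b) * row_form t b ^ (m - 2))"

text \<open>
The number of fixed-point-free permutations that are compatible with a word of content \<open>M\<close>, each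
weighted by \<open>t\<close> to the number of its excedances. One block polynomial stands for each letter of \<open>M\<close>,
and the coefficient of \<open>M\<close> enforces that the letters written in the places have content \<open>M\<close> as well.
\<close>

definition derangement_coeff :: "'a::comm_ring_1 \<Rightarrow> nat multiset \<Rightarrow> 'a" where
  "derangement_coeff t M =
     mcoeff (\<Prod>b\<in>set_mset M. derangement_block t b (count M b)) M"

text \<open>
Factors for absent letters are 1, so the product may run over any larger alphabet. This lets the
contents \<open>M - A\<close> be treated over the fixed alphabet of \<open>M\<close>.
\<close>

lemma derangement_coeff_superset:
  assumes "finite B" "set_mset M \<subseteq> B"
  shows "derangement_coeff t M = mcoeff (\<Prod>b\<in>B. derangement_block t b (count M b)) M"
  unfolding derangement_coeff_def using assms
  by (subst prod.mono_neutral_left[of B "set_mset M"])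
    (auto simp: derangement_block_def not_in_iff)

lemma derangement_coeff_empty [simp]: "derangement_coeff t {#} = 1"
  by (simp add: derangement_coeff_def mcoeff_simps)

text \<open>
A block of \<open>m\<close> places ends in a run of \<open>i\<close> fixed points for some \<open>i\<close>, each of weight \<open>a\<close>, and its
first \<open>m - i\<close> places contain none.
\<close>

definition weighted_block :: "'a::comm_ring_1 \<Rightarrow> 'a \<Rightarrow> nat \<Rightarrow> nat \<Rightarrow> 'a mpseries" where
  "weighted_block t a b m =
     (\<Sum>i\<le>m. mscale (a ^ i) (mvar b ^ i) * derangement_block t b (m - i))"

lemma weighted_block_0 [simp]: "weighted_block t a b 0 = 1"
  by (simp add: weighted_block_def derangement_block_def)

lemma weighted_block_Suc:
  "weighted_block t a b (Suc m) = derangement_block t b (Suc m)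
     + mscale a (mvar b) * weighted_block t a b m"
proof -
  have "weighted_block t a b (Suc m) = derangement_block t b (Suc m) +
     (\<Sum>i\<le>m. mscale (a ^ Suc i) (mvar b ^ Suc i) * derangement_block t b (m - i))"
    unfolding weighted_block_def by (subst sum.atMost_Suc_shift) simp
  also have "(\<Sum>i\<le>m. mscale (a ^ Suc i) (mvar b ^ Suc i) * derangement_block t b (m - i))
     = mscale a (mvar b) * weighted_block t a b m"
    by (simp add: weighted_block_def sum_distrib_left mscale_mult mscale_mult_left
        mscale_mult_right mult_ac)
  finally show ?thesis .
qed

text \<open>
With weight 1 the fixed points impose no condition on the end of the block, and only the
restriction at its first place remains.
\<close>

lemma weighted_block_1:
  "weighted_block t 1 b (Suc m) = cut_form t (Suc b) * row_form t b ^ m"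
proof (induction m)
  case 0
  show ?case
    by (simp add: weighted_block_Suc derangement_block_def cut_form_Suc cut_form_eq[of t b])
next
  case (Suc m)
  show ?case
    by (subst weighted_block_Suc, subst Suc)
      (simp add: derangement_block_def cut_form_eq[of t b] algebra_simps)
qed

text \<open>
With weight \<open>t\<close> a trailing unbarred \<open>b\<close> counts as much as a barred one. The roles of the two cuts in
the previous lemma are exchanged, and the same induction applies.
\<close>

lemma weighted_block_t:
  "weighted_block t t b (Suc m) = cut_form t b * row_form t b ^ m"
proof (induction m)
  case 0
  show ?case
    by (simp add: weighted_block_Suc derangement_block_def)
next
  case (Suc m)
  show ?case
    by (subst weighted_block_Suc, subst Suc)
      (simp add: derangement_block_def cut_form_Suc algebra_simps)
qed

lemma prod_mono_power:
  assumes "finite B" "set_mset A \<subseteq> B"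
  shows "(\<Prod>b\<in>B. mvar b ^ count A b) = mono_series A"
proof -
  have "(\<Sum>b\<in>B. replicate_mset (count A b) b) = A"
    using assms by (auto simp: multiset_eq_iff count_sum if_distrib not_in_iff cong: if_cong)
  with assms show ?thesis by (simp add: mono_series_power mono_series_prod)
qed

lemma size_eq_sum_count: "finite B \<Longrightarrow> set_mset A \<subseteq> B \<Longrightarrow> size A = (\<Sum>b\<in>B. count A b)"
  by (simp add: size_multiset_overloaded_eq) (rule sum.mono_neutral_left, auto simp: not_in_iff)

text \<open>
Choosing a multiplicity for each letter of \<open>M\<close> is the same as choosing a submultiset.
\<close>

lemma sum_PiE_submultisets:
  fixes M :: "'b multiset"
  shows "(\<Sum>g \<in> (\<Pi>\<^sub>E b\<in>set_mset M. {..count M b}). F g)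
     = (\<Sum>A | A \<subseteq># M. F (restrict (count A) (set_mset M)))"
proof (rule sum.reindex_bij_witness[where
      i = "\<lambda>A. restrict (count A) (set_mset M)" and
      j = "\<lambda>g. \<Sum>b\<in>set_mset M. replicate_mset (g b) b"])
  fix g assume g: "g \<in> (\<Pi>\<^sub>E b\<in>set_mset M. {..count M b})"
  have c: "count (\<Sum>b\<in>set_mset M. replicate_mset (g b) b) x
      = (if x \<in># M then g x else 0)" for x
    by (auto simp: count_sum if_distrib cong: if_cong)
  show *: "restrict (count (\<Sum>b\<in>set_mset M. replicate_mset (g b) b)) (set_mset M) = g"
    using g by (auto simp: fun_eq_iff c PiE_def extensional_def)
  show "(\<Sum>b\<in>set_mset M. replicate_mset (g b) b) \<in> {A. A \<subseteq># M}"
    using g by (auto simp: subseteq_mset_def c)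
  show "F (restrict (count (\<Sum>b\<in>set_mset M. replicate_mset (g b) b)) (set_mset M)) = F g"
    by (simp only: *)
next
  fix A assume "A \<in> {A. A \<subseteq># M}"
  then have A: "A \<subseteq># M" by simp
  then have "x \<notin># M \<Longrightarrow> x \<notin># A" for x by (auto dest: mset_subset_eqD)
  then have *: "x \<notin># M \<Longrightarrow> count A x = 0" for x by (simp add: not_in_iff)
  then show "(\<Sum>b\<in>set_mset M. replicate_mset (restrict (count A) (set_mset M) b) b) = A"
    by (auto simp: multiset_eq_iff count_sum if_distrib not_in_iff cong: if_cong)
  show "restrict (count A) (set_mset M) \<in> (\<Pi>\<^sub>E b\<in>set_mset M. {..count M b})"
    using A by (auto simp: subseteq_mset_def)
qed

text \<open>
Multiplying the series of derangements by the series with coefficients \<open>a\<close> to the size of the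
monomial is done block by block, since the monomial \<open>A\<close> factors over its letters.
\<close>

lemma convolution_derangement_coeff:
  "(\<Sum>A | A \<subseteq># M. a ^ size A * derangement_coeff t (M - A))
     = mcoeff (\<Prod>b\<in>set_mset M. weighted_block t a b (count M b)) M"
proof -
  let ?B = "set_mset M"
  have "(\<Prod>b\<in>?B. weighted_block t a b (count M b))
     = (\<Sum>g \<in> (\<Pi>\<^sub>E b\<in>?B. {..count M b}). \<Prod>b\<in>?B. mscale (a ^ g b) (mvar b ^ g b)
          * derangement_block t b (count M b - g b))"
    unfolding weighted_block_def by (subst prod_sum_PiE) auto
  also have "\<dots> = (\<Sum>A | A \<subseteq># M. mscale (a ^ size A) (mono_series A)
          * (\<Prod>b\<in>?B. derangement_block t b (count (M - A) b)))"
    unfolding sum_PiE_submultisets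
  proof (rule sum.cong)
    fix A assume "A \<in> {A. A \<subseteq># M}"
    then have A: "set_mset A \<subseteq> ?B" by (auto dest: mset_subset_eqD)
    have "(\<Prod>b\<in>?B. mscale (a ^ count A b) (mvar b ^ count A b))
        = mscale (a ^ size A) (mono_series A)"
      using A by (simp add: mscale_prod prod_mono_power power_sum size_eq_sum_count[of ?B])
    then show "(\<Prod>b\<in>?B. mscale (a ^ restrict (count A) ?B b) (mvar b ^ restrict (count A) ?B b)
          * derangement_block t b (count M b - restrict (count A) ?B b))
        = mscale (a ^ size A) (mono_series A)
          * (\<Prod>b\<in>?B. derangement_block t b (count (M - A) b))"
      by (simp add: prod.distrib)
  qed simp
  also have "mcoeff \<dots> M = (\<Sum>A | A \<subseteq># M. a ^ size A * derangement_coeff t (M - A))"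
    unfolding mcoeff_sum
  proof (rule sum.cong)
    fix A assume "A \<in> {A. A \<subseteq># M}"
    moreover have "derangement_coeff t (M - A)
        = mcoeff (\<Prod>b\<in>?B. derangement_block t b (count (M - A) b)) (M - A)"
      by (rule derangement_coeff_superset) (auto dest: in_diffD)
    ultimately show "mcoeff (mscale (a ^ size A) (mono_series A)
          * (\<Prod>b\<in>?B. derangement_block t b (count (M - A) b))) M
        = a ^ size A * derangement_coeff t (M - A)"
      by (simp add: mscale_mult_left mcoeff_mono_mult del: count_diff)
  qed simp
  finally show ?thesis ..
qed

section \<open>The cyclic telescoping\<close>

lemma agree_on_cut_form_Suc:
  "b \<notin> B \<Longrightarrow> agree_on B (cut_form t b) (cut_form t (Suc b))"
  unfolding cut_form_def by (rule agree_on_lin_formI) (auto simp: not_less_eq_eq dest: le_antisym)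

text \<open>
Replace the cut at each letter by the cut just above it, from the smallest letter upwards: moving a
cut across a number outside the alphabet changes nothing there, and at each letter the pending cut
\<open>cut_form t a\<close> is passed on.
\<close>

lemma prod_cut_form_telescope:
  assumes "finite B" "b0 \<in> B" "\<And>b. b \<in> B \<Longrightarrow> b0 \<le> b" "b0 < a"
  shows "agree_on B ((\<Prod>b\<in>{b\<in>B - {b0}. b < a}. cut_form t b) * cut_form t a)
     (\<Prod>b\<in>{b\<in>B. b < a}. cut_form t (Suc b))"
  using \<open>b0 < a\<close>
proof (induction a rule: dec_induct[OF Suc_leI])
  show "b0 < a" by fact
next
  have *: "{b\<in>B - {b0}. b < Suc b0} = {}" "{b\<in>B. b < Suc b0} = {b0}"
    using assms by fastforce+
  show "agree_on B ((\<Prod>b\<in>{b\<in>B - {b0}. b < Suc b0}. cut_form t b) * cut_form t (Suc b0))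
     (\<Prod>b\<in>{b\<in>B. b < Suc b0}. cut_form t (Suc b))"
    unfolding * by simp
next
  fix a
  assume a: "Suc b0 \<le> a" and IH: "b0 < a \<Longrightarrow> agree_on B ((\<Prod>b\<in>{b\<in>B - {b0}. b < a}. cut_form t b) * cut_form t a)
     (\<Prod>b\<in>{b\<in>B. b < a}. cut_form t (Suc b))"
  show "agree_on B ((\<Prod>b\<in>{b\<in>B - {b0}. b < Suc a}. cut_form t b) * cut_form t (Suc a))
     (\<Prod>b\<in>{b\<in>B. b < Suc a}. cut_form t (Suc b))"
  proof (cases "a \<in> B")
    case True
    with a have *: "{b\<in>B - {b0}. b < Suc a} = insert a {b\<in>B - {b0}. b < a}"
        "{b\<in>B. b < Suc a} = insert a {b\<in>B. b < a}" by auto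
    show ?thesis
      unfolding * using assms(1) agree_on_mult[OF IH agree_on_refl[of B "cut_form t (Suc a)"]] a
      by (simp add: mult_ac)
  next
    case False
    then have "b < Suc a \<longleftrightarrow> b < a" if "b \<in> B" for b using that by (auto simp: less_Suc_eq)
    then have *: "{b\<in>B - {b0}. b < Suc a} = {b\<in>B - {b0}. b < a}"
        "{b\<in>B. b < Suc a} = {b\<in>B. b < a}" by auto
    show ?thesis unfolding *
      by (rule agree_on_trans[OF agree_on_mult[OF agree_on_refl agree_on_sym] IH])
        (use False a in \<open>auto intro: agree_on_cut_form_Suc\<close>)
  qed
qed

lemma prod_cut_form_cyclic:
  assumes "finite B" "B \<noteq> {}"
  shows "agree_on B (\<Prod>b\<in>B. cut_form t b) (mscale t (\<Prod>b\<in>B. cut_form t (Suc b)))"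
proof -
  define b0 a where "b0 = Min B" and "a = Suc (Max B)"
  have b0: "b0 \<in> B" "\<And>b. b \<in> B \<Longrightarrow> b0 \<le> b" and a: "\<And>b. b \<in> B \<Longrightarrow> b < a"
    using assms by (auto simp: b0_def a_def less_Suc_eq_le)
  from a have *: "{b\<in>B - {b0}. b < a} = B - {b0}" "{b\<in>B. b < a} = B" by auto
  \<comment> \<open>On the alphabet, the cuts below and above all letters differ by the factor \<open>t\<close>.\<close>
  have "agree_on B (cut_form t b0) (mscale t (cut_form t a))"
  proof -
    have "agree_on B (cut_form t b0) (lin_form (\<lambda>c. t * (if a \<le> c then t else 1)))"
      unfolding cut_form_def using b0 by (intro agree_on_lin_formI) (fastforce dest: a)
    moreover have "lin_form (\<lambda>c. t * (if a \<le> c then t else 1)) = mscale t (cut_form t a)"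
      by (rule mpseries_eqI) (simp add: cut_form_def lin_form_def)
    ultimately show ?thesis by simp
  qed
  then have "agree_on B (cut_form t b0 * (\<Prod>b\<in>B - {b0}. cut_form t b))
      (mscale t (cut_form t a) * (\<Prod>b\<in>B - {b0}. cut_form t b))"
    by (intro agree_on_mult agree_on_refl)
  also have "cut_form t b0 * (\<Prod>b\<in>B - {b0}. cut_form t b) = (\<Prod>b\<in>B. cut_form t b)"
    using assms b0 by (simp add: prod.remove)
  also have "mscale t (cut_form t a) * (\<Prod>b\<in>B - {b0}. cut_form t b)
      = mscale t ((\<Prod>b\<in>B - {b0}. cut_form t b) * cut_form t a)"
    by (simp add: mscale_mult_left mult.commute)
  also have "agree_on B \<dots> (mscale t (\<Prod>b\<in>B. cut_form t (Suc b)))"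
    using prod_cut_form_telescope[of B b0 a t, unfolded *] assms b0 a[OF b0(1)]
    by (intro agree_on_mscale) blast
  finally show ?thesis .
qed

text \<open>
This is the identity \<open>D \<cdot> (H(t) - t H(1)) = 1 - t\<close> in positive degree, where \<open>D\<close> is the series of the
derangement coefficients and \<open>H(a)\<close> the one with coefficients \<open>a\<close> to the size of the monomial. By the
two evaluations of a weighted block, the sides differ only in where the linear forms are cut, and
the product of the cut forms is cyclic.
\<close>

lemma derangement_coeff_functional_equation:
  assumes "M \<noteq> {#}"
  shows "(\<Sum>A | A \<subseteq># M. (t ^ size A - t) * derangement_coeff t (M - A)) = 0"
proof -
  let ?B = "set_mset M"
  let ?L = "\<Prod>b\<in>?B. row_form t b ^ (count M b - 1)"
  \<comment> \<open>Every block is nonempty, so it contributes exactly one cut form.\<close>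
  have s: "\<And>b. b \<in> ?B \<Longrightarrow> count M b = Suc (count M b - 1)" by simp
  have 1: "(\<Prod>b\<in>?B. weighted_block t 1 b (count M b)) = (\<Prod>b\<in>?B. cut_form t (Suc b)) * ?L"
    unfolding prod.distrib[symmetric] by (rule prod.cong[OF refl]) (metis s weighted_block_1)
  have 2: "(\<Prod>b\<in>?B. weighted_block t t b (count M b)) = (\<Prod>b\<in>?B. cut_form t b) * ?L"
    unfolding prod.distrib[symmetric] by (rule prod.cong[OF refl]) (metis s weighted_block_t)
  have "agree_on ?B ((\<Prod>b\<in>?B. cut_form t b) * ?L) (mscale t (\<Prod>b\<in>?B. cut_form t (Suc b)) * ?L)"
    using assms by (intro agree_on_mult agree_on_refl prod_cut_form_cyclic) auto
  then have "mcoeff (\<Prod>b\<in>?B. weighted_block t t b (count M b)) M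
      = t * mcoeff (\<Prod>b\<in>?B. weighted_block t 1 b (count M b)) M"
    unfolding 1 2 by (simp add: agree_on_def mscale_mult_left)
  then have "(\<Sum>A | A \<subseteq># M. t ^ size A * derangement_coeff t (M - A))
      = t * (\<Sum>A | A \<subseteq># M. derangement_coeff t (M - A))"
    unfolding convolution_derangement_coeff[symmetric] by simp
  then show ?thesis
    by (simp add: left_diff_distrib sum_subtractf sum_distrib_left)
qed

section \<open>The recurrence for derangements\<close>

text \<open>
The functional equation divided by \<open>t - 1\<close>. Here \<open>t\<^sup>i - t\<close> becomes \<open>t + \<dots> + t\<^sup>i\<^sup>-\<^sup>1\<close>, the empty
submultiset yields the left-hand side, and singletons contribute nothing.
\<close>

lemma derangement_coeff_recurrence:
  fixes t :: "'a::idom"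
  assumes "M \<noteq> {#}" "t \<noteq> 1"
  shows "derangement_coeff t M
    = (\<Sum>A | A \<subseteq># M \<and> 2 \<le> size A. (\<Sum>l\<in>{1..<size A}. t ^ l) * derangement_coeff t (M - A))"
proof -
  define g where "g = (\<lambda>i. if i = 0 then -1 else \<Sum>l\<in>{1..<i}. t ^ l)"
  have g: "t ^ i - t = (t - 1) * g i" for i
  proof (cases i)
    case (Suc k)
    have "(t - 1) * (\<Sum>l\<in>{1..<Suc k}. t ^ l) = t ^ Suc k - t"
      by (induction k) (auto simp: algebra_simps)
    with Suc show ?thesis by (simp add: g_def)
  qed (simp add: g_def)
  have "(t - 1) * (\<Sum>A | A \<subseteq># M. g (size A) * derangement_coeff t (M - A)) = 0"
    using derangement_coeff_functional_equation[OF assms(1), of t]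
    by (simp add: g sum_distrib_left mult.assoc)
  then have "0 = (\<Sum>A | A \<subseteq># M. g (size A) * derangement_coeff t (M - A))"
    using assms(2) by simp
  also have "\<dots> = (\<Sum>A \<in> insert {#} {A. A \<subseteq># M \<and> 2 \<le> size A}. g (size A) * derangement_coeff t (M - A))"
  proof (rule sum.mono_neutral_right)
    show "\<forall>A\<in>{A. A \<subseteq># M} - insert {#} {A. A \<subseteq># M \<and> 2 \<le> size A}.
        g (size A) * derangement_coeff t (M - A) = 0"
    proof
      fix A assume "A \<in> {A. A \<subseteq># M} - insert {#} {A. A \<subseteq># M \<and> 2 \<le> size A}"
      then have "A \<noteq> {#}" "\<not> 2 \<le> size A" by auto
      then have "size A = 1" by (metis One_nat_def Suc_1 less_2_cases not_le size_eq_0_iff_empty)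
      then show "g (size A) * derangement_coeff t (M - A) = 0" by (simp add: g_def)
    qed
  qed (auto simp: finite_submultisets)
  also have "\<dots> = - derangement_coeff t M
      + (\<Sum>A | A \<subseteq># M \<and> 2 \<le> size A. g (size A) * derangement_coeff t (M - A))"
    by (subst sum.insert) (auto simp: finite_submultisets g_def)
  also have "(\<Sum>A | A \<subseteq># M \<and> 2 \<le> size A. g (size A) * derangement_coeff t (M - A))
     = (\<Sum>A | A \<subseteq># M \<and> 2 \<le> size A. (\<Sum>l\<in>{1..<size A}. t ^ l) * derangement_coeff t (M - A))"
    by (rule sum.cong) (auto simp: g_def)
  finally show ?thesis by (simp add: eq_neg_iff_add_eq_0 algebra_simps)
qed

lemma mcoeff_complete_h_mult:
  "mcoeff (complete_h i * f) M = (\<Sum>A | A \<subseteq># M \<and> size A = i. mcoeff f (M - A))"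
proof -
  have "mcoeff (complete_h i * f) M
      = (\<Sum>(A, B) \<in> (\<lambda>A. (A, M - A)) ` {A. A \<subseteq># M \<and> size A = i}. mcoeff (complete_h i) A * mcoeff f B)"
    unfolding mcoeff_simps
    by (rule sum.mono_neutral_right)
      (auto simp: finite_multiset_splits complete_h_def split: if_splits)
  also have "\<dots> = (\<Sum>A | A \<subseteq># M \<and> size A = i. mcoeff f (M - A))"
    by (subst sum.reindex) (auto simp: inj_on_def complete_h_def)
  finally show ?thesis .
qed

definition pgeom :: "nat \<Rightarrow> rat mpseries poly" where
  "pgeom k = (\<Sum>l<k. monom 1 l)"

text \<open>
The polynomials \<open>D\<^sub>n\<close>, defined by the recurrence that displays their positivity.
\<close>

fun derangement_poly :: "nat \<Rightarrow> rat mpseries poly" where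
  "derangement_poly n = (if n = 0 then 1
     else \<Sum>i\<in>{2..n}. smult (complete_h i) (monom 1 1 * pgeom (i - 1) * derangement_poly (n - i)))"

declare derangement_poly.simps [simp del]

lemma derangement_poly_0 [simp]: "derangement_poly 0 = 1"
  by (simp add: derangement_poly.simps)

lemma derangement_poly_rec: "n > 0 \<Longrightarrow> derangement_poly n
    = (\<Sum>i\<in>{2..n}. smult (complete_h i) (monom 1 1 * pgeom (i - 1) * derangement_poly (n - i)))"
  by (subst derangement_poly.simps) simp

abbreviation tvar :: "rat poly" where "tvar \<equiv> monom 1 1"

lemma coeff_pgeom_shift_mult:
  "coeff (monom 1 1 * pgeom (i - 1) * p) j = (\<Sum>l\<in>{1..<i}. if l \<le> j then coeff p (j - l) else 0)"
proof -
  have "monom 1 1 * pgeom (i - 1) = (\<Sum>l<i-1. monom 1 (Suc l))"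
    by (simp add: pgeom_def sum_distrib_left mult_monom)
  also have "\<dots> = (\<Sum>l\<in>{1..<i}. monom 1 l)"
    by (rule sum.reindex_bij_witness[where i = "\<lambda>l. l - 1" and j = Suc]) auto
  finally show ?thesis
    by (auto simp: sum_distrib_right coeff_sum coeff_monom_mult intro!: sum.cong)
qed

text \<open>
Both sides satisfy the same recurrence: multiplication by \<open>h\<^sub>i\<close> sums over the submultisets of size
\<open>i\<close>.
\<close>

lemma mcoeff_derangement_poly:
  "mcoeff (coeff (derangement_poly n) j) M
     = (if size M = n then coeff (derangement_coeff tvar M) j else 0)"
proof (induction n arbitrary: j M rule: less_induct)
  case (less n)
  show ?case
  proof (cases "n = 0")
    case True
    then show ?thesis by (auto simp: mcoeff_simps coeff_1)
  next
    case False
    have "mcoeff (coeff (derangement_poly n) j) M = (\<Sum>i\<in>{2..n}. \<Sum>A | A \<subseteq># M \<and> size A = i.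
        \<Sum>l\<in>{1..<i}. if l \<le> j then mcoeff (coeff (derangement_poly (n - i)) (j - l)) (M - A) else 0)"
      using False
      by (simp add: derangement_poly_rec coeff_sum mcoeff_sum coeff_smult mcoeff_complete_h_mult
          coeff_pgeom_shift_mult if_distrib[of "\<lambda>f. mcoeff f _"] mcoeff_simps(1) del: One_nat_def cong: if_cong)
    also have "\<dots> = (\<Sum>i\<in>{2..n}. \<Sum>A | A \<subseteq># M \<and> size A = i.
        if size M = n then coeff ((\<Sum>l\<in>{1..<size A}. tvar ^ l) * derangement_coeff tvar (M - A)) j else 0)"
    proof (intro sum.cong refl)
      fix i A assume i: "i \<in> {2..n}" and A: "A \<in> {A. A \<subseteq># M \<and> size A = i}"
      then have s: "size (M - A) = n - i \<longleftrightarrow> size M = n"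
        using size_mset_mono[of A M] by (auto simp: size_Diff_submset)
      have "(\<Sum>l\<in>{1..<i}. if l \<le> j then mcoeff (coeff (derangement_poly (n - i)) (j - l)) (M - A) else 0)
         = (\<Sum>l\<in>{1..<i}. if l \<le> j then if size M = n then
              coeff (derangement_coeff tvar (M - A)) (j - l) else 0 else 0)"
        using i by (subst less.IH) (auto simp: s cong: if_cong)
      also have "\<dots> = (if size M = n then coeff ((\<Sum>l\<in>{1..<size A}. tvar ^ l) * derangement_coeff tvar (M - A)) j else 0)"
        using A by (auto simp: sum_distrib_right coeff_sum monom_power coeff_monom_mult
            intro!: sum.cong sum.neutral)
      finally show "(\<Sum>l\<in>{1..<i}. if l \<le> j then mcoeff (coeff (derangement_poly (n - i)) (j - l)) (M - A) else 0)
        = (if size M = n then coeff ((\<Sum>l\<in>{1..<size A}. tvar ^ l) * derangement_coeff tvar (M - A)) j else 0)" .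
    qed
    also have "\<dots> = (\<Sum>A | A \<subseteq># M \<and> 2 \<le> size A \<and> size A \<le> n.
        if size M = n then coeff ((\<Sum>l\<in>{1..<size A}. tvar ^ l) * derangement_coeff tvar (M - A)) j else 0)"
    proof -
      have "sum (\<lambda>i. sum F {A \<in> {A. A \<subseteq># M \<and> 2 \<le> size A \<and> size A \<le> n}. size A = i}) {2..n}
        = sum F {A. A \<subseteq># M \<and> 2 \<le> size A \<and> size A \<le> n}" for F :: "_ \<Rightarrow> rat"
        by (rule sum.group) (auto simp: finite_submultisets)
      moreover have "{A \<in> {A. A \<subseteq># M \<and> 2 \<le> size A \<and> size A \<le> n}. size A = i} = {A. A \<subseteq># M \<and> size A = i}"
        if "i \<in> {2..n}" for i using that by auto
      ultimately show ?thesis by (metis (no_types, lifting) sum.cong)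
    qed
    also have "\<dots> = (if size M = n then coeff (derangement_coeff tvar M) j else 0)"
    proof (cases "size M = n")
      case True
      have "{A. A \<subseteq># M \<and> 2 \<le> size A \<and> size A \<le> n} = {A. A \<subseteq># M \<and> 2 \<le> size A}"
        using True by (auto dest: size_mset_mono)
      moreover have "tvar \<noteq> 1" by (simp add: monom_eq_1_iff)
      moreover have "M \<noteq> {#}" using True False by auto
      ultimately show ?thesis
        using True by (subst derangement_coeff_recurrence[of M tvar])
          (simp_all add: coeff_sum del: One_nat_def)
    qed simp
    finally show ?thesis .
  qed
qed

section \<open>Positivity in the h-basis\<close>

lemma h_prod_add_mset: "h_prod (add_mset i \<mu>) = complete_h i * h_prod \<mu>"
  by (simp add: h_prod_def)

lemma complete_h_0 [simp]: "complete_h 0 = 1"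
  by (rule mpseries_eqI) (simp add: complete_h_def mcoeff_simps)

lemma mscale_0_left [simp]: "mscale 0 f = 0"
  by (rule mpseries_eqI) (simp add: mcoeff_simps)

lemma mscale_add_left: "mscale (c + d) f = mscale c f + mscale d f"
  by (rule mpseries_eqI) (simp add: mcoeff_simps algebra_simps)

lemma h_positive_0 [simp]: "h_positive 0"
  unfolding h_positive_def by (rule exI[of _ "{}"]) simp

lemma h_positive_1 [simp]: "h_positive 1"
  unfolding h_positive_def
  by (rule exI[of _ "{{#}}"], rule exI[of _ "\<lambda>_. 1"]) (simp add: h_prod_def is_partition_def)

lemma h_positive_add:
  assumes "h_positive f" "h_positive g"
  shows "h_positive (f + g)"
proof -
  obtain P c where P: "finite P" "\<forall>\<mu>\<in>P. is_partition \<mu> \<and> c \<mu> \<ge> 0"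
      "f = (\<Sum>\<mu>\<in>P. mscale (c \<mu>) (h_prod \<mu>))"
    using assms(1) unfolding h_positive_def by blast
  obtain Q d where Q: "finite Q" "\<forall>\<mu>\<in>Q. is_partition \<mu> \<and> d \<mu> \<ge> 0"
      "g = (\<Sum>\<mu>\<in>Q. mscale (d \<mu>) (h_prod \<mu>))"
    using assms(2) unfolding h_positive_def by blast
  define e where "e = (\<lambda>\<mu>. (if \<mu> \<in> P then c \<mu> else 0) + (if \<mu> \<in> Q then d \<mu> else 0))"
  have "f = (\<Sum>\<mu>\<in>P \<union> Q. mscale (if \<mu> \<in> P then c \<mu> else 0) (h_prod \<mu>))"
    unfolding P(3) using P Q by (intro sum.mono_neutral_cong_left) auto
  moreover have "g = (\<Sum>\<mu>\<in>P \<union> Q. mscale (if \<mu> \<in> Q then d \<mu> else 0) (h_prod \<mu>))"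
    unfolding Q(3) using P Q by (intro sum.mono_neutral_cong_left) auto
  ultimately have "f + g = (\<Sum>\<mu>\<in>P \<union> Q. mscale (e \<mu>) (h_prod \<mu>))"
    by (simp add: e_def mscale_add_left sum.distrib)
  moreover have "\<forall>\<mu>\<in>P \<union> Q. is_partition \<mu> \<and> e \<mu> \<ge> 0" using P Q by (auto simp: e_def)
  ultimately show ?thesis using P Q unfolding h_positive_def by blast
qed

lemma h_positive_sum: "(\<And>x. x \<in> A \<Longrightarrow> h_positive (f x)) \<Longrightarrow> h_positive (sum f A)"
  by (induction A rule: infinite_finite_induct) (auto intro: h_positive_add)

text \<open>
Multiplication by \<open>h\<^sub>i\<close> adds the part \<open>i\<close> to each partition, except that \<open>h\<^sub>0 = 1\<close> must not create a
part 0.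
\<close>

lemma h_positive_complete_h_mult:
  assumes "h_positive f"
  shows "h_positive (complete_h i * f)"
proof (cases "i = 0")
  case False
  obtain P c where P: "finite P" "\<forall>\<mu>\<in>P. is_partition \<mu> \<and> c \<mu> \<ge> 0"
      "f = (\<Sum>\<mu>\<in>P. mscale (c \<mu>) (h_prod \<mu>))"
    using assms unfolding h_positive_def by blast
  have "complete_h i * f = (\<Sum>\<mu>\<in>add_mset i ` P. mscale (c (\<mu> - {#i#})) (h_prod \<mu>))"
    by (subst sum.reindex)
      (auto simp: inj_on_def P(3) sum_distrib_left mscale_mult_right h_prod_add_mset)
  with P False show ?thesis unfolding h_positive_def
    by (intro exI[of _ "add_mset i ` P"] exI[of _ "\<lambda>\<mu>. c (\<mu> - {#i#})"])
      (auto simp: is_partition_def)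
qed (use assms in simp)

lemma symmetric_function_add: "symmetric_function f \<Longrightarrow> symmetric_function g \<Longrightarrow> symmetric_function (f + g)"
  unfolding symmetric_function_def mcoeff_simps
  by (metis (no_types, lifting) add.right_neutral le_trans nat_le_linear)

lemma symmetric_function_0: "symmetric_function 0"
  by (auto simp: symmetric_function_def mcoeff_simps)

lemma symmetric_function_sum:
  "(\<And>x. x \<in> A \<Longrightarrow> symmetric_function (f x)) \<Longrightarrow> symmetric_function (sum f A)"
  by (induction A rule: infinite_finite_induct)
    (auto intro: symmetric_function_add symmetric_function_0)

lemma symmetric_function_mscale: "symmetric_function f \<Longrightarrow> symmetric_function (mscale c f)"
  unfolding symmetric_function_def by (metis mcoeff_mscale mult_zero_right)

lemma symmetric_function_complete_h: "symmetric_function (complete_h i)"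
  by (auto simp: symmetric_function_def complete_h_def)

lemma symmetric_function_1: "symmetric_function 1"
  by (auto simp: symmetric_function_def mcoeff_simps)

text \<open>
A bijection of the variables permutes the factorizations of a monomial.
\<close>

lemma symmetric_function_mult:
  assumes "symmetric_function f" "symmetric_function g"
  shows "symmetric_function (f * g)"
  unfolding symmetric_function_def
proof (intro conjI allI impI)
  fix \<pi> :: "nat \<Rightarrow> nat" and M assume \<pi>: "bij \<pi>"
  have inv: "image_mset (inv \<pi>) (image_mset \<pi> A) = A" "image_mset \<pi> (image_mset (inv \<pi>) A) = A" for A
    using \<pi> by (simp_all add: multiset.map_comp o_def bij_is_inj bij_is_surj surj_f_inv_f)
  have f: "mcoeff f (image_mset \<pi> A) = mcoeff f A" and g: "mcoeff g (image_mset \<pi> A) = mcoeff g A" for A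
    using assms \<pi> by (auto simp: symmetric_function_def)
  have "{(A, B). A + B = image_mset \<pi> M} = map_prod (image_mset \<pi>) (image_mset \<pi>) ` {(A, B). A + B = M}"
  proof (intro equalityI subsetI)
    fix p assume "p \<in> {(A, B). A + B = image_mset \<pi> M}"
    then obtain A B where p: "p = (A, B)" "A + B = image_mset \<pi> M" by auto
    have "image_mset (inv \<pi>) (A + B) = M" by (simp only: p(2) inv(1))
    then have "image_mset (inv \<pi>) A + image_mset (inv \<pi>) B = M" by (simp only: image_mset_union)
    then show "p \<in> map_prod (image_mset \<pi>) (image_mset \<pi>) ` {(A, B). A + B = M}"
      using p(1) by (intro image_eqI[of _ _ "(image_mset (inv \<pi>) A, image_mset (inv \<pi>) B)"]) (simp_all only: map_prod_simp inv(2) mem_Collect_eq case_prod_conv)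
  qed auto
  moreover have "inj_on (map_prod (image_mset \<pi>) (image_mset \<pi>)) {(A, B). A + B = M}"
    by (rule inj_on_inverseI[where g = "map_prod (image_mset (inv \<pi>)) (image_mset (inv \<pi>))"])
      (clarsimp simp only: map_prod_simp inv(1))
  ultimately show "mcoeff (f * g) (image_mset \<pi> M) = mcoeff (f * g) M"
    unfolding mcoeff_simps by (simp add: sum.reindex case_prod_unfold f g)
next
  obtain d e where d: "\<And>M. mcoeff f M \<noteq> 0 \<Longrightarrow> size M \<le> d" and e: "\<And>M. mcoeff g M \<noteq> 0 \<Longrightarrow> size M \<le> e"
    using assms unfolding symmetric_function_def by blast
  show "\<exists>d. \<forall>M. mcoeff (f * g) M \<noteq> 0 \<longrightarrow> size M \<le> d"
  proof (intro exI allI impI)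
    fix M assume "mcoeff (f * g) M \<noteq> 0"
    then have "(\<Sum>p\<in>{(A, B). A + B = M}. case p of (A, B) \<Rightarrow> mcoeff f A * mcoeff g B) \<noteq> 0"
      by (simp only: mcoeff_simps not_False_eq_True)
    then obtain p where p: "p \<in> {(A, B). A + B = M}" "(case p of (A, B) \<Rightarrow> mcoeff f A * mcoeff g B) \<noteq> 0"
      by (rule sum.not_neutral_contains_not_neutral)
    obtain A B where AB: "p = (A, B)" by (cases p)
    with p have "A + B = M" "mcoeff f A \<noteq> 0" "mcoeff g B \<noteq> 0" by auto
    then show "size M \<le> d + e" using d[of A] e[of B] by auto
  qed
qed

lemma symmetric_function_h_prod: "symmetric_function (h_prod \<mu>)"
  by (induction \<mu>)
    (auto simp: h_prod_add_mset symmetric_function_complete_h intro!: symmetric_function_mult,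
     simp add: h_prod_def symmetric_function_1)

lemma h_positive_imp_symmetric: "h_positive f \<Longrightarrow> symmetric_function f"
  unfolding h_positive_def
  by (auto intro!: symmetric_function_sum symmetric_function_mscale symmetric_function_h_prod)

section \<open>Palindromic unimodal polynomials\<close>

text \<open>
Coefficients indexed by all integers, zero outside the range of the polynomial, so that reflections
and shifts of the index need no side conditions.
\<close>

definition icoeff :: "'a::zero poly \<Rightarrow> int \<Rightarrow> 'a" where
  "icoeff p i = (if i < 0 then 0 else coeff p (nat i))"

text \<open>
Palindromic about \<open>d/2\<close>, and weakly increasing towards the center. The condition \<open>i + j \<le> d\<close> says that \<open>j\<close> is at
least as close to the center as \<open>i \<le> j\<close>. As \<open>i\<close> may be far to the left, where all coefficients vanish,
h-positivity of the coefficients is included. Unlike the degree and the lowest exponent of the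
polynomial, the parameter \<open>d\<close> makes sense for the zero polynomial and is stable under addition.
\<close>

definition h_unimodal :: "int \<Rightarrow> rat mpseries poly \<Rightarrow> bool" where
  "h_unimodal d p \<longleftrightarrow> (\<forall>i. icoeff p i = icoeff p (d - i)) \<and>
     (\<forall>i j. i \<le> j \<longrightarrow> i + j \<le> d \<longrightarrow> h_positive (icoeff p j - icoeff p i))"

lemma icoeff_of_nat [simp]: "icoeff p (int i) = coeff p i"
  by (simp add: icoeff_def)

text \<open>
Comparing neighbours suffices: a \<open>j\<close> beyond the center can be reflected to \<open>d - j\<close>, which still is at
least \<open>i\<close>.
\<close>

lemma h_unimodalI:
  assumes sym: "\<And>i. icoeff p i = icoeff p (d - i)"
    and step: "\<And>i. 2 * i + 1 \<le> d \<Longrightarrow> h_positive (icoeff p (i + 1) - icoeff p i)"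
  shows "h_unimodal d p"
  unfolding h_unimodal_def
proof (intro conjI allI impI)
  fix i j :: int
  assume ij: "i \<le> j" "i + j \<le> d"
  have mono: "h_positive (icoeff p j - icoeff p i)" if "i \<le> j" "2 * j \<le> d + 1" for j
    using that
  proof (induction j rule: int_ge_induct)
    case (step j)
    have "icoeff p (j + 1) - icoeff p i
        = (icoeff p (j + 1) - icoeff p j) + (icoeff p j - icoeff p i)" by simp
    moreover have "h_positive (icoeff p (j + 1) - icoeff p j)"
      using step.prems by (intro assms(2)) (simp add: algebra_simps)
    moreover have "h_positive (icoeff p j - icoeff p i)"
      using step by auto
    ultimately show ?case by (simp only: h_positive_add)
  qed simp
  show "h_positive (icoeff p j - icoeff p i)"
  proof (cases "2 * j \<le> d + 1")
    case True
    with ij mono show ?thesis by blast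
  next
    case False
    then have "h_positive (icoeff p (d - j) - icoeff p i)" using ij by (intro mono) auto
    then show ?thesis using sym[of j] by simp
  qed
qed (rule sym)

lemma h_unimodalD:
  assumes "h_unimodal d p"
  shows "icoeff p i = icoeff p (d - i)"
    and "i \<le> j \<Longrightarrow> i + j \<le> d \<Longrightarrow> h_positive (icoeff p j - icoeff p i)"
  using assms unfolding h_unimodal_def by blast+

lemma h_unimodal_h_positive:
  assumes "h_unimodal d p"
  shows "h_positive (coeff p i)"
proof -
  \<comment> \<open>A negative index, far enough to the left to be comparable with \<open>i\<close>.\<close>
  have "h_positive (icoeff p (int i) - icoeff p (- 1 - \<bar>d\<bar> - int i))"
    by (rule h_unimodalD(2)[OF assms]) auto
  moreover have "icoeff p (- 1 - \<bar>d\<bar> - int i) = 0"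
    unfolding icoeff_def by (rule if_P) linarith
  ultimately show ?thesis by simp
qed

lemma h_unimodal_1: "h_unimodal 0 1"
  by (rule h_unimodalI) (auto simp: icoeff_def coeff_1)

lemma h_unimodal_0: "h_unimodal d 0"
  by (rule h_unimodalI) (auto simp: icoeff_def)

lemma h_unimodal_add:
  assumes "h_unimodal d p" "h_unimodal d q"
  shows "h_unimodal d (p + q)"
proof -
  have *: "icoeff (p + q) i = icoeff p i + icoeff q i" for i by (simp add: icoeff_def)
  have "icoeff (p + q) j - icoeff (p + q) i = (icoeff p j - icoeff p i) + (icoeff q j - icoeff q i)" for i j
    by (simp add: * algebra_simps)
  then show ?thesis using assms unfolding h_unimodal_def by (metis * h_positive_add)
qed

lemma h_unimodal_sum: "(\<And>x. x \<in> A \<Longrightarrow> h_unimodal d (f x)) \<Longrightarrow> h_unimodal d (sum f A)"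
  by (induction A rule: infinite_finite_induct) (auto intro: h_unimodal_add h_unimodal_0)

lemma h_unimodal_smult:
  assumes "h_unimodal d p"
  shows "h_unimodal d (smult (complete_h k) p)"
proof -
  have *: "icoeff (smult (complete_h k) p) i = complete_h k * icoeff p i" for i by (simp add: icoeff_def)
  show ?thesis
    using assms unfolding h_unimodal_def *
    by (metis h_positive_complete_h_mult right_diff_distrib)
qed

lemma h_unimodal_shift:
  assumes "h_unimodal d p"
  shows "h_unimodal (d + 2) (monom 1 1 * p)"
proof -
  have *: "icoeff (monom 1 1 * p) i = icoeff p (i - 1)" for i
    by (auto simp: icoeff_def coeff_monom_mult nat_diff_distrib)
  have s: "icoeff p i = icoeff p (d - i)" for i
    using assms unfolding h_unimodal_def by blast
  show ?thesis
  proof (rule h_unimodalI)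
    show "icoeff (monom 1 1 * p) i = icoeff (monom 1 1 * p) (d + 2 - i)" for i
    proof -
      have "d + 2 - i - 1 = d - (i - 1)" by simp
      then show ?thesis using s[of "i - 1"] by (simp only: *)
    qed
    show "h_positive (icoeff (monom 1 1 * p) (i + 1) - icoeff (monom 1 1 * p) i)" if "2 * i + 1 \<le> d + 2" for i
      using assms that unfolding h_unimodal_def * by auto
  qed
qed

lemma icoeff_pgeom_mult: "icoeff (pgeom k * p) i = (\<Sum>l<k. icoeff p (i - int l))"
  by (auto simp: icoeff_def pgeom_def sum_distrib_right coeff_sum coeff_monom_mult nat_diff_distrib
      intro!: sum.cong)

text \<open>
Coefficients of the product are sums over windows of \<open>Suc k\<close> consecutive coefficients of \<open>p\<close>. Moving the
window by one step exchanges a coefficient for one that is at least as close to the center.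
\<close>

lemma h_unimodal_pgeom:
  assumes "h_unimodal d p"
  shows "h_unimodal (d + int k) (pgeom (Suc k) * p)"
proof (rule h_unimodalI)
  have s: "icoeff p i = icoeff p (d - i)" for i
    using assms unfolding h_unimodal_def by blast
  show "icoeff (pgeom (Suc k) * p) i = icoeff (pgeom (Suc k) * p) (d + int k - i)" for i
  proof -
    have "(\<Sum>l<Suc k. icoeff p (i - int l)) = (\<Sum>l<Suc k. icoeff p (d - (i - int (k - l))))"
      by (subst sum.nat_diff_reindex[symmetric], rule sum.cong) (auto simp: s[symmetric])
    also have "\<dots> = (\<Sum>l<Suc k. icoeff p (d + int k - i - int l))"
      by (rule sum.cong) (auto simp: of_nat_diff algebra_simps)
    finally show ?thesis by (simp only: icoeff_pgeom_mult)
  qed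
  fix i assume i: "2 * i + 1 \<le> d + int k"
  have "icoeff (pgeom (Suc k) * p) (i + 1) = icoeff p (i + 1) + (\<Sum>l<k. icoeff p (i - int l))"
    unfolding icoeff_pgeom_mult by (subst sum.lessThan_Suc_shift) simp
  moreover have "icoeff (pgeom (Suc k) * p) i = (\<Sum>l<k. icoeff p (i - int l)) + icoeff p (i - int k)"
    unfolding icoeff_pgeom_mult by simp
  moreover have "h_positive (icoeff p (i + 1) - icoeff p (i - int k))"
    using assms i unfolding h_unimodal_def by auto
  ultimately show "h_positive (icoeff (pgeom (Suc k) * p) (i + 1) - icoeff (pgeom (Suc k) * p) i)"
    by simp
qed

lemma h_unimodal_derangement_poly: "h_unimodal (int n) (derangement_poly n)"
proof (induction n rule: less_induct)
  case (less n)
  show ?case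
  proof (cases "n = 0")
    case True
    then show ?thesis using h_unimodal_1 by simp
  next
    case False
    then have n: "n > 0" by simp
    show ?thesis unfolding derangement_poly_rec[OF n]
    proof (intro h_unimodal_sum h_unimodal_smult)
      fix i assume i: "i \<in> {2..n}"
      then obtain k where k: "i = Suc (Suc k)" by (metis atLeastAtMost_iff numeral_2_eq_2 Suc_le_D Suc_le_mono)
      have "h_unimodal (int (n - i)) (derangement_poly (n - i))" using i by (intro less.IH) auto
      from h_unimodal_shift[OF h_unimodal_pgeom[OF this, of k]]
      show "h_unimodal (int n) (monom 1 1 * pgeom (i - 1) * derangement_poly (n - i))"
        using i by (simp add: k mult.assoc of_nat_diff)
    qed
  qed
qed

text \<open>
Absorb \<open>D\<^sub>n\<close>, the term for \<open>k = 0\<close>, by its recurrence: the weight of \<open>h\<^sub>i D\<^bsub>n-i\<^esub>\<close> becomes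
\<open>1 + (t + \<dots> + t\<^sup>i\<^sup>-\<^sup>1)\<close>. In this form all summands have the same center, whereas the terms
\<open>h\<^sub>k D\<^bsub>n-k\<^esub>\<close> have different ones.
\<close>

lemma sum_derangement_poly:
  assumes "n > 0"
  shows "(\<Sum>k\<le>n. smult (complete_h k) (derangement_poly (n - k)))
     = (\<Sum>i\<in>{1..n}. smult (complete_h i) (pgeom i * derangement_poly (n - i)))"
proof -
  have g: "pgeom i = 1 + monom 1 1 * pgeom (i - 1)" if i: "i \<ge> 1" for i
  proof -
    obtain k where "i = Suc k" using i by (cases i) auto
    moreover have "pgeom (Suc k) = 1 + (\<Sum>l<k. monom 1 (Suc l))"
      unfolding pgeom_def sum.lessThan_Suc_shift by (simp only: monom_0 one_pCons)
    moreover have "(\<Sum>l<k. monom 1 (Suc l)) = monom 1 1 * pgeom k"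
      by (simp only: pgeom_def sum_distrib_left mult_monom mult_1 plus_1_eq_Suc)
    ultimately show ?thesis by (simp only: diff_Suc_1)
  qed
  have "(\<Sum>k\<le>n. smult (complete_h k) (derangement_poly (n - k)))
      = derangement_poly n + (\<Sum>k\<in>{1..n}. smult (complete_h k) (derangement_poly (n - k)))"
    unfolding atMost_atLeast0 by (subst sum.atLeast_Suc_atMost) simp_all
  also have "derangement_poly n
      = (\<Sum>i\<in>{1..n}. smult (complete_h i) (monom 1 1 * pgeom (i - 1) * derangement_poly (n - i)))"
    unfolding derangement_poly_rec[OF assms]
    by (rule sum.mono_neutral_left) (auto simp: pgeom_def not_le)
  finally have "(\<Sum>k\<le>n. smult (complete_h k) (derangement_poly (n - k)))
      = (\<Sum>i\<in>{1..n}. smult (complete_h i) (monom 1 1 * pgeom (i - 1) * derangement_poly (n - i))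
          + smult (complete_h i) (derangement_poly (n - i)))"
    by (simp only: sum.distrib)
  also have "\<dots> = (\<Sum>i\<in>{1..n}. smult (complete_h i) (pgeom i * derangement_poly (n - i)))"
  proof (rule sum.cong[OF refl])
    fix i assume "i \<in> {1..n}"
    then have "pgeom i * derangement_poly (n - i)
        = monom 1 1 * pgeom (i - 1) * derangement_poly (n - i) + derangement_poly (n - i)"
      using g[of i] by (simp only: atLeastAtMost_iff distrib_right mult_1 add.commute)
    then show "smult (complete_h i) (monom 1 1 * pgeom (i - 1) * derangement_poly (n - i))
          + smult (complete_h i) (derangement_poly (n - i))
        = smult (complete_h i) (pgeom i * derangement_poly (n - i))"
      by (simp only: smult_add_right)
  qed
  finally show ?thesis .
qed

lemma h_unimodal_full:
  assumes "n > 0"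
  shows "h_unimodal (int n - 1) (\<Sum>k\<le>n. smult (complete_h k) (derangement_poly (n - k)))"
  unfolding sum_derangement_poly[OF assms]
proof (intro h_unimodal_sum h_unimodal_smult)
  fix i assume i: "i \<in> {1..n}"
  then obtain k where k: "i = Suc k" by (metis atLeastAtMost_iff Suc_le_D One_nat_def)
  from h_unimodal_pgeom[OF h_unimodal_derangement_poly[of "n - i"], of k]
  show "h_unimodal (int n - 1) (pgeom i * derangement_poly (n - i))"
    using i by (simp add: k of_nat_diff)
qed

text \<open>
The constant term is \<open>h\<^sub>n\<close>, since \<open>D\<^sub>m\<close> is divisible by \<open>t\<close> for \<open>m > 0\<close>.
\<close>

lemma coeff_full_0_neq_0:
  assumes "n > 0"
  shows "coeff (\<Sum>k\<le>n. smult (complete_h k) (derangement_poly (n - k))) 0 \<noteq> 0"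
proof -
  have 0: "coeff (derangement_poly m) 0 = (if m = 0 then 1 else 0)" for m
    by (cases "m = 0") (auto simp: derangement_poly_rec coeff_sum coeff_monom_mult mult.assoc)
  have "coeff (\<Sum>k\<le>n. smult (complete_h k) (derangement_poly (n - k))) 0
      = (\<Sum>k\<le>n. if k = n then complete_h k else 0)"
    unfolding coeff_sum coeff_smult 0 by (rule sum.cong) auto
  also have "\<dots> = complete_h n" by simp
  also have "\<dots> \<noteq> 0"
    by (auto simp: mpseries_eq_iff complete_h_def mcoeff_simps intro!: exI[of _ "replicate_mset n 0"])
  finally show ?thesis .
qed

text \<open>
Reflection about \<open>d/2\<close> exchanges the largest and the smallest exponent.
\<close>

lemma h_unimodal_degree:
  assumes "h_unimodal d p" "p \<noteq> 0"
  shows "int (degree p) + int (low_degree p) = d"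
proof -
  have s: "icoeff p i = icoeff p (d - i)" for i
    using assms unfolding h_unimodal_def by blast
  have low: "coeff p (low_degree p) \<noteq> 0" unfolding low_degree_def
    by (rule LeastI_ex) (metis assms(2) leading_coeff_neq_0)
  have low_le: "low_degree p \<le> i" if "coeff p i \<noteq> 0" for i
    unfolding low_degree_def by (rule Least_le) (rule that)
  have "icoeff p (d - int (low_degree p)) \<noteq> 0" 
    using s[of "int (low_degree p)"] low by (metis icoeff_of_nat)
  then have 1: "d - int (low_degree p) \<ge> 0" "nat (d - int (low_degree p)) \<le> degree p"
    by (auto simp: icoeff_def le_degree split: if_splits)
  have "icoeff p (d - int (degree p)) \<noteq> 0" 
    using s[of "int (degree p)"] assms(2) by (metis icoeff_of_nat leading_coeff_0_iff)
  then have 2: "d - int (degree p) \<ge> 0" "low_degree p \<le> nat (d - int (degree p))"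
    by (auto simp: icoeff_def low_le split: if_splits)
  from 1 2 show ?thesis by linarith
qed

lemma h_unimodal_imp:
  assumes "h_unimodal d p" "p \<noteq> 0"
  shows "t_symmetric p" "t_unimodal h_le p" "center_of_symmetry p = of_int d / 2"
proof -
  define r s where "r = low_degree p" and "s = degree p"
  note d = h_unimodal_degree[OF assms, folded r_def s_def]
  have sym: "icoeff p i = icoeff p (d - i)" for i
    using assms unfolding h_unimodal_def by blast
  have r_le: "r \<le> s" unfolding r_def s_def low_degree_def
    by (rule Least_le) (use assms in simp)
  have sym': "coeff p i = coeff p j" if "i + j = s + r" for i j
    using sym[of "int i"] that d by (metis icoeff_of_nat add_diff_cancel_left' of_nat_add)
  show ts: "t_symmetric p"
    unfolding t_symmetric_def Let_def r_def[symmetric] s_def[symmetric]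
    using assms(2) r_le by (auto intro!: sym')
  have le: "h_le (coeff p i) (coeff p j)" if "i \<le> j" "i + j \<le> s + r" for i j
  proof -
    have "h_positive (icoeff p (int j) - icoeff p (int i))"
      by (rule h_unimodalD(2)[OF assms(1)]) (use that d in auto)
    then show ?thesis
      using h_unimodal_h_positive[OF assms(1)] by (simp add: h_le_def h_positive_imp_symmetric)
  qed
  show "t_unimodal h_le p"
    unfolding t_unimodal_def Let_def r_def[symmetric] s_def[symmetric]
  proof (intro conjI allI impI ts)
    fix i assume "r \<le> i \<and> i < (s + r) div 2"
    then show "h_le (coeff p i) (coeff p (i + 1))" by (intro le) auto
  next
    show "coeff p ((s + r) div 2) = coeff p ((s + r + 1) div 2)"
      by (rule sym') presburger
  next
    fix i assume i: "(s + r + 1) div 2 \<le> i \<and> i < s"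
    have "coeff p i = coeff p (s + r - i)" "coeff p (i + 1) = coeff p (s + r - (i + 1))"
      using i by (auto intro!: sym')
    then show "h_le (coeff p (i + 1)) (coeff p i)"
      using i by (auto intro!: le)
  qed
  have "of_nat s + of_nat r = (of_int d :: rat)"
    using d by (metis of_int_add of_int_of_nat_eq)
  then show "center_of_symmetry p = of_int d / 2"
    by (simp add: center_of_symmetry_def r_def s_def)
qed

section \<open>Permutations compatible with a word and barred words\<close>

lemma down_closed_iff:
  assumes "S \<subseteq> {1..n}" "\<And>i j. i \<in> S \<Longrightarrow> 1 \<le> j \<Longrightarrow> j \<le> i \<Longrightarrow> j \<in> S" "1 \<le> i"
  shows "i \<in> S \<longleftrightarrow> i \<le> card (S :: nat set)"
proof
  assume "i \<in> S"
  then have "{1..i} \<subseteq> S" using assms(2) by auto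
  then show "i \<le> card S" using card_mono[of S "{1..i}"] assms(1) finite_subset by fastforce
next
  assume i: "i \<le> card S"
  show "i \<in> S"
  proof (rule ccontr)
    assume "i \<notin> S"
    then have "S \<subseteq> {1..<i}" using assms by (metis atLeastAtMost_iff atLeastLessThan_iff not_le subset_iff)
    then show False using card_mono[of "{1..<i}" S] i assms(3) by simp
  qed
qed

lemma up_closed_iff:
  assumes "S \<subseteq> {s<..e}" "\<And>i j. i \<in> S \<Longrightarrow> i \<le> j \<Longrightarrow> j \<le> e \<Longrightarrow> j \<in> S" "i \<in> {s<..e}"
  shows "i \<in> S \<longleftrightarrow> e - card S < (i :: nat)"
proof (cases "i \<in> S")
  case True
  then have "{i..e} \<subseteq> S" using assms(2) by auto
  then have "card {i..e} \<le> card S" using card_mono assms(1) finite_subset finite_greaterThanAtMost by metis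
  then show ?thesis using True assms(3) by auto
next
  case False
  then have "S \<subseteq> {i<..e}" using assms by (auto simp: subset_iff) (metis not_le)
  then have "card S \<le> card {i<..e}" by (intro card_mono) auto
  then show ?thesis using False assms(3) by auto
qed

lemma card_filter_eq_size:
  "finite I \<Longrightarrow> card {i\<in>I. P (f i)} = size (filter_mset P (image_mset f (mset_set I)))"
  by (simp add: filter_mset_image_mset)

text \<open>
A weakly decreasing word \<open>v\<close> on the positions 1 to \<open>n\<close>; a block consists of the positions with the same
label.
\<close>

locale block_word =
  fixes n :: nat and v :: "nat \<Rightarrow> nat"
  assumes antitone: "1 \<le> i \<Longrightarrow> i \<le> j \<Longrightarrow> j \<le> n \<Longrightarrow> v j \<le> v i"
begin

definition content :: "nat multiset" where
  "content = image_mset v (mset_set {1..n})"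

text \<open>
The block of \<open>b\<close> is the interval from \<open>Suc (block_start b)\<close> to \<open>block_end b\<close>.
\<close>

definition block_start :: "nat \<Rightarrow> nat" where
  "block_start b = size (filter_mset (\<lambda>c. b < c) content)"

definition block_end :: "nat \<Rightarrow> nat" where
  "block_end b = size (filter_mset (\<lambda>c. b \<le> c) content)"

lemma less_v_iff:
  assumes "i \<in> {1..n}"
  shows "b < v i \<longleftrightarrow> i \<le> block_start b"
proof -
  have "i \<in> {i\<in>{1..n}. b < v i} \<longleftrightarrow> i \<le> card {i\<in>{1..n}. b < v i}"
    by (rule down_closed_iff) (use assms antitone in \<open>auto intro: less_le_trans\<close>)
  moreover have "card {i\<in>{1..n}. b < v i} = block_start b"
    unfolding block_start_def content_def by (rule card_filter_eq_size) simp
  ultimately show ?thesis using assms by simp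
qed

lemma le_v_iff:
  assumes "i \<in> {1..n}"
  shows "b \<le> v i \<longleftrightarrow> i \<le> block_end b"
proof -
  have "i \<in> {i\<in>{1..n}. b \<le> v i} \<longleftrightarrow> i \<le> card {i\<in>{1..n}. b \<le> v i}"
    by (rule down_closed_iff) (use assms antitone in \<open>auto intro: le_trans\<close>)
  moreover have "card {i\<in>{1..n}. b \<le> v i} = block_end b"
    unfolding block_end_def content_def by (rule card_filter_eq_size) simp
  ultimately show ?thesis using assms by simp
qed

lemma block_end_le: "block_end b \<le> n"
  unfolding block_end_def content_def by (metis card_atLeastAtMost diff_Suc_1 size_filter_mset_lesseq size_image_mset size_mset_set)

lemma block_end_eq: "block_end b = block_start b + count content b"
proof -
  have "block_end b = size (filter_mset (\<lambda>c. b < c) content + filter_mset (\<lambda>c. c = b) content)"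
    unfolding block_end_def
    by (rule arg_cong[of _ _ size]) (auto simp: multiset_eq_iff)
  then show ?thesis by (simp add: block_start_def filter_eq_replicate_mset)
qed

lemma block_eq: "{i\<in>{1..n}. v i = b} = {block_start b<..block_end b}"
proof (intro equalityI subsetI)
  fix i assume "i \<in> {i\<in>{1..n}. v i = b}"
  then show "i \<in> {block_start b<..block_end b}"
    using less_v_iff[of i b] le_v_iff[of i b] by auto
next
  fix i assume i: "i \<in> {block_start b<..block_end b}"
  then have "i \<in> {1..n}" using block_end_le[of b] by auto
  then show "i \<in> {i\<in>{1..n}. v i = b}"
    using i less_v_iff[of i b] le_v_iff[of i b] by auto
qed

text \<open>
A weakly decreasing word is determined by its content, because the content determines where its
blocks begin and end.
\<close>

lemma antitone_unique:
  assumes "\<And>i j. 1 \<le> i \<Longrightarrow> i \<le> j \<Longrightarrow> j \<le> n \<Longrightarrow> f j \<le> f i"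
    and "image_mset f (mset_set {1..n}) = content" and i: "i \<in> {1..n}"
  shows "f i = v i"
proof -
  interpret f: block_word n f by unfold_locales (rule assms(1))
  have "f.content = content" using assms(2) by (simp add: f.content_def)
  then have "b \<le> f i \<longleftrightarrow> b \<le> v i" for b
    using f.le_v_iff[OF i] le_v_iff[OF i] by (simp add: f.block_end_def block_end_def)
  then show ?thesis by (metis order_antisym order_refl)
qed

definition compatible :: "(nat \<Rightarrow> nat) \<Rightarrow> bool" where
  "compatible \<sigma> \<longleftrightarrow> \<sigma> permutes {1..n} \<and> (\<forall>i\<in>DEX n \<sigma>. v (i + 1) < v i)"

lemma EXC_iff:
  assumes "\<sigma> permutes {1..n}"
  shows "i \<in> EXC n \<sigma> \<longleftrightarrow> i \<in> {1..n} \<and> i < \<sigma> i"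
proof -
  have "i \<in> {1..n} \<Longrightarrow> \<sigma> i \<in> {1..n}" using assms permutes_in_image by metis
  then show ?thesis by (auto simp: EXC_def)
qed

text \<open>
The order of the barred letters at the positions \<open>p\<close> and \<open>q\<close>, in terms of \<open>\<sigma>\<close> alone.
\<close>

definition before :: "(nat \<Rightarrow> nat) \<Rightarrow> nat \<Rightarrow> nat \<Rightarrow> bool" where
  "before \<sigma> p q \<longleftrightarrow> (p < \<sigma> p \<and> \<not> q < \<sigma> q) \<or> ((p < \<sigma> p \<longleftrightarrow> q < \<sigma> q) \<and> \<sigma> p < \<sigma> q)"

lemma letter_less_iff_before:
  assumes "\<sigma> permutes {1..n}" "p \<in> {1..n}" "q \<in> {1..n}"
  shows "letter_less (bar_letter n \<sigma> p) (bar_letter n \<sigma> q) \<longleftrightarrow> before \<sigma> p q"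
  using assms by (auto simp: bar_letter_def before_def EXC_iff)

text \<open>
The condition on neighbours spreads over a whole block since the letters are distinct and linearly
ordered.
\<close>

lemma compatible_iff:
  "compatible \<sigma> \<longleftrightarrow> \<sigma> permutes {1..n} \<and>
     (\<forall>p q. 1 \<le> p \<longrightarrow> p < q \<longrightarrow> q \<le> n \<longrightarrow> v p = v q \<longrightarrow> before \<sigma> p q)"
proof (cases "\<sigma> permutes {1..n}")
  case \<sigma>: True
  have inj: "\<sigma> p = \<sigma> q \<longleftrightarrow> p = q" for p q using \<sigma> by (meson permutes_inj injD)
  have dex: "i \<in> DEX n \<sigma> \<longleftrightarrow> 1 \<le> i \<and> i < n \<and> before \<sigma> (i + 1) i" for i
    using letter_less_iff_before[OF \<sigma>, of "i + 1" i] by (auto simp: DEX_def)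
  have step: "before \<sigma> i (i + 1)" if "compatible \<sigma>" "1 \<le> i" "i < n" "v i = v (i + 1)" for i
    using that dex[of i] inj[of i "i + 1"] by (auto simp: compatible_def before_def)
  have "before \<sigma> p q" if c: "compatible \<sigma>" and "1 \<le> p" "p < q" "q \<le> n" "v p = v q" for p q
    using \<open>p < q\<close> \<open>q \<le> n\<close> \<open>v p = v q\<close>
  proof (induction q)
    case (Suc q)
    show ?case
    proof (cases "p = q")
      case True
      then show ?thesis using step[OF c \<open>1 \<le> p\<close>] Suc.prems by auto
    next
      case False
      with Suc.prems have pq: "p < q" "q < n" by auto
      then have "v q = v p" using antitone[of p q] antitone[of q "Suc q"] \<open>1 \<le> p\<close> Suc.prems by auto
      then have "before \<sigma> p q" "before \<sigma> q (Suc q)"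
        using Suc pq step[OF c, of q] \<open>1 \<le> p\<close> by auto
      then show ?thesis by (auto simp: before_def)
    qed
  qed simp
  moreover have "compatible \<sigma>"
    if *: "\<And>p q. 1 \<le> p \<Longrightarrow> p < q \<Longrightarrow> q \<le> n \<Longrightarrow> v p = v q \<Longrightarrow> before \<sigma> p q"
    unfolding compatible_def
  proof (intro conjI ballI \<sigma>)
    fix i assume "i \<in> DEX n \<sigma>"
    then have i: "1 \<le> i" "i < n" "before \<sigma> (i + 1) i" by (auto simp: dex)
    then have "\<not> before \<sigma> i (i + 1)" by (auto simp: before_def)
    then have "v i \<noteq> v (i + 1)" using *[of i "i + 1"] i by auto
    then show "v (i + 1) < v i" using antitone[of i "i + 1"] i by auto
  qed
  ultimately show ?thesis using \<sigma> by blast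
qed (simp add: compatible_def)

text \<open>
The barred word of a permutation, indexed by values: the label of the position that \<open>i\<close> comes from,
with a bar (\<open>True\<close>) if that position is an excedance.
\<close>

definition code :: "(nat \<Rightarrow> nat) \<Rightarrow> nat \<Rightarrow> nat \<times> bool" where
  "code \<sigma> = (\<lambda>i\<in>{1..n}. (v (inv \<sigma> i), inv \<sigma> i < i))"

text \<open>
The order in which the entries of a word are numbered by its standardization: larger labels first,
then barred before unbarred, then from left to right.
\<close>

definition prec :: "(nat \<Rightarrow> nat \<times> bool) \<Rightarrow> nat \<Rightarrow> nat \<Rightarrow> bool" where
  "prec g i j \<longleftrightarrow> fst (g j) < fst (g i) \<or> (fst (g i) = fst (g j) \<and>
     ((snd (g i) \<and> \<not> snd (g j)) \<or> ((snd (g i) \<longleftrightarrow> snd (g j)) \<and> i < j)))"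

definition rank :: "(nat \<Rightarrow> nat \<times> bool) \<Rightarrow> nat \<Rightarrow> nat" where
  "rank g i = Suc (card {j\<in>{1..n}. prec g j i})"

lemma prec_trans: "prec g i j \<Longrightarrow> prec g j k \<Longrightarrow> prec g i k"
  and prec_irrefl: "\<not> prec g i i"
  and prec_total: "i \<noteq> j \<Longrightarrow> prec g i j \<or> prec g j i"
  by (auto simp: prec_def)

lemma permutes_inv_mem:
  assumes "\<sigma> permutes {1..n}"
  shows "inv \<sigma> i \<in> {1..n} \<longleftrightarrow> i \<in> {1..n}" "\<sigma> (inv \<sigma> i) = i" "inv \<sigma> (\<sigma> i) = i"
  using permutes_in_image[OF permutes_inv[OF assms]] permutes_inverses[OF assms] by auto

text \<open>
For a compatible permutation, the inverse is increasing with respect to this order: positions run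
through the labels in decreasing order, and within a block through the excedances and then the other
positions, with increasing values in both parts.
\<close>

lemma prec_code_iff:
  assumes "compatible \<sigma>" "i \<in> {1..n}" "j \<in> {1..n}"
  shows "prec (code \<sigma>) i j \<longleftrightarrow> inv \<sigma> i < inv \<sigma> j"
proof -
  have \<sigma>: "\<sigma> permutes {1..n}"
    and c: "\<And>p q. 1 \<le> p \<Longrightarrow> p < q \<Longrightarrow> q \<le> n \<Longrightarrow> v p = v q \<Longrightarrow> before \<sigma> p q"
    using assms(1) by (auto simp: compatible_iff)
  note s = permutes_inv_mem[OF \<sigma>]
  have *: "prec (code \<sigma>) i j" if "i \<in> {1..n}" "j \<in> {1..n}" "inv \<sigma> i < inv \<sigma> j" for i j
  proof -
    have "inv \<sigma> i \<in> {1..n}" "inv \<sigma> j \<in> {1..n}" using that s(1) by auto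
    then have "v (inv \<sigma> j) < v (inv \<sigma> i) \<or> (v (inv \<sigma> j) = v (inv \<sigma> i) \<and> before \<sigma> (inv \<sigma> i) (inv \<sigma> j))"
      using antitone[of "inv \<sigma> i" "inv \<sigma> j"] c[of "inv \<sigma> i" "inv \<sigma> j"] that(3) by fastforce
    then show ?thesis using that by (auto simp: prec_def code_def before_def s)
  qed
  show ?thesis
    using *[OF assms(2,3)] *[OF assms(3,2)] prec_trans prec_irrefl s(2)
    by (metis linorder_neqE_nat)
qed

lemma rank_code:
  assumes "compatible \<sigma>" "i \<in> {1..n}"
  shows "rank (code \<sigma>) i = inv \<sigma> i"
proof -
  have \<sigma>: "\<sigma> permutes {1..n}" using assms by (simp add: compatible_def)
  note s = permutes_inv_mem[OF \<sigma>]
  have "{j\<in>{1..n}. prec (code \<sigma>) j i} = \<sigma> ` {1..<inv \<sigma> i}"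
  proof (intro equalityI subsetI)
    fix j assume "j \<in> {j\<in>{1..n}. prec (code \<sigma>) j i}"
    then have j: "j \<in> {1..n}" "inv \<sigma> j < inv \<sigma> i" using prec_code_iff assms by auto
    then have "inv \<sigma> j \<in> {1..<inv \<sigma> i}" using s(1)[of j] by auto
    then show "j \<in> \<sigma> ` {1..<inv \<sigma> i}" using s(2)[of j] by (metis imageI)
  next
    fix j assume "j \<in> \<sigma> ` {1..<inv \<sigma> i}"
    then obtain p where p: "j = \<sigma> p" "1 \<le> p" "p < inv \<sigma> i" by auto
    moreover have "inv \<sigma> i \<le> n" using s(1)[of i] assms by auto
    ultimately have "j \<in> {1..n}" using permutes_in_image[OF \<sigma>, of p] by auto
    then show "j \<in> {j\<in>{1..n}. prec (code \<sigma>) j i}" using prec_code_iff assms p s(3) by auto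
  qed
  then have "card {j\<in>{1..n}. prec (code \<sigma>) j i} = inv \<sigma> i - 1"
    using permutes_inj[OF \<sigma>] by (simp add: card_image inj_on_subset)
  moreover have "inv \<sigma> i \<ge> 1" using s(1)[of i] assms by auto
  ultimately show ?thesis by (simp add: rank_def)
qed

lemma inj_on_code: "inj_on code {\<sigma>. compatible \<sigma>}"
proof (rule inj_onI)
  fix \<sigma> \<tau> assume "\<sigma> \<in> {\<sigma>. compatible \<sigma>}" "\<tau> \<in> {\<sigma>. compatible \<sigma>}" and eq: "code \<sigma> = code \<tau>"
  then have c: "compatible \<sigma>" "compatible \<tau>" by auto
  then have p: "\<sigma> permutes {1..n}" "\<tau> permutes {1..n}" by (auto simp: compatible_def)
  have "inv \<sigma> i = inv \<tau> i" for i
  proof (cases "i \<in> {1..n}")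
    case True
    then show ?thesis using rank_code[OF c(1)] rank_code[OF c(2)] eq by metis
  next
    case False
    then show ?thesis using p by (metis permutes_inv permutes_not_in)
  qed
  then show "\<sigma> = \<tau>" using p by (metis ext permutes_inv_inv)
qed

text \<open>
The letters that a compatible permutation may have at place \<open>i\<close>. A barred \<open>v i\<close> at the first place of the
block is impossible, since it would have to come from an earlier place of the same block.
\<close>

definition admissible :: "nat \<Rightarrow> nat \<times> bool \<Rightarrow> bool" where
  "admissible i x \<longleftrightarrow> (if snd x then v i < fst x \<or> (fst x = v i \<and> i \<noteq> Suc (block_start (v i)))
     else fst x \<le> v i)"

lemma code_admissible:
  assumes "compatible \<sigma>" "i \<in> {1..n}"
  shows "admissible i (code \<sigma> i)"
proof -
  have \<sigma>: "\<sigma> permutes {1..n}" using assms by (simp add: compatible_def)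
  let ?q = "inv \<sigma> i"
  have q: "?q \<in> {1..n}" using permutes_inv_mem[OF \<sigma>] assms by auto
  show ?thesis
  proof (cases "?q < i")
    case True
    then have "v i \<le> v ?q" using antitone[of ?q i] q assms by auto
    moreover have "i \<noteq> Suc (block_start (v i))" if "v ?q = v i"
      using less_v_iff[of ?q "v i"] that q True by auto
    ultimately show ?thesis using assms True by (auto simp: admissible_def code_def)
  next
    case False
    then have "v ?q \<le> v i" using antitone[of i ?q] q assms by auto
    then show ?thesis using assms False by (auto simp: admissible_def code_def)
  qed
qed

lemma code_content:
  assumes "\<sigma> permutes {1..n}"
  shows "image_mset (\<lambda>i. fst (code \<sigma> i)) (mset_set {1..n}) = content"
proof -
  have "image_mset (\<lambda>i. fst (code \<sigma> i)) (mset_set {1..n}) = image_mset (\<lambda>i. v (inv \<sigma> i)) (mset_set {1..n})"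
    by (rule image_mset_cong) (auto simp: code_def)
  also have "\<dots> = image_mset v (image_mset (inv \<sigma>) (mset_set {1..n}))"
    by (simp add: multiset.map_comp o_def)
  also have "image_mset (inv \<sigma>) (mset_set {1..n}) = mset_set {1..n}"
    using assms permutes_inv[OF assms]
    by (subst image_mset_mset_set) (auto simp: permutes_image intro: permutes_inj_on)
  finally show ?thesis by (simp add: content_def)
qed

lemma rank_less_iff:
  assumes "i \<in> {1..n}" "j \<in> {1..n}"
  shows "rank g i < rank g j \<longleftrightarrow> prec g i j"
proof -
  have *: "rank g i < rank g j" if "prec g i j" "i \<in> {1..n}" for i j
  proof -
    have "{k\<in>{1..n}. prec g k i} \<subset> {k\<in>{1..n}. prec g k j}"
      using that prec_trans prec_irrefl by blast
    then have "card {k\<in>{1..n}. prec g k i} < card {k\<in>{1..n}. prec g k j}"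
      by (intro psubset_card_mono) auto
    then show ?thesis by (simp add: rank_def)
  qed
  show ?thesis
    using *[of i j] *[of j i] assms prec_total[of i j g] by fastforce
qed

lemma rank_mem: "i \<in> {1..n} \<Longrightarrow> rank g i \<in> {1..n}"
proof -
  assume i: "i \<in> {1..n}"
  have "card {j\<in>{1..n}. prec g j i} \<le> card ({1..n} - {i})"
    by (intro card_mono) (auto simp: prec_irrefl)
  then show "rank g i \<in> {1..n}" using i by (auto simp: rank_def)
qed

text \<open>
Standardization inverts the coding. The substance is that admissibility, a condition on each place
alone, forces the bars to mark exactly the places \<open>i\<close> whose rank is below \<open>i\<close>. If the label of \<open>i\<close>
differs from \<open>v i\<close>, this is clear from the position of the blocks. If they are equal, it follows by
counting the entries numbered before \<open>i\<close>.
\<close>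

lemma code_surj:
  assumes content: "image_mset (\<lambda>i. fst (g i)) (mset_set {1..n}) = content"
    and adm: "\<And>i. i \<in> {1..n} \<Longrightarrow> admissible i (g i)"
    and ext: "g \<in> extensional {1..n}"
  obtains \<sigma> where "compatible \<sigma>" "code \<sigma> = g"
proof -
  define \<tau> where "\<tau> = (\<lambda>i. if i \<in> {1..n} then rank g i else i)"
  have inj: "inj_on \<tau> {1..n}"
  proof (rule inj_onI)
    fix i j assume ij: "i \<in> {1..n}" "j \<in> {1..n}" "\<tau> i = \<tau> j"
    then have "rank g i = rank g j" by (simp add: \<tau>_def)
    then show "i = j"
      using ij prec_total[of i j g] rank_less_iff[of i j g] rank_less_iff[of j i g] by auto
  qed
  have "\<tau> ` {1..n} \<subseteq> {1..n}" using rank_mem by (auto simp: \<tau>_def)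
  then have "\<tau> ` {1..n} = {1..n}" using inj by (intro endo_inj_surj) auto
  with inj have "bij_betw \<tau> {1..n} {1..n}" by (simp add: bij_betw_def)
  then have \<tau>: "\<tau> permutes {1..n}" by (rule bij_imp_permutes) (simp only: \<tau>_def if_False)
  define \<sigma> where "\<sigma> = inv \<tau>"
  have \<sigma>: "\<sigma> permutes {1..n}" unfolding \<sigma>_def by (rule permutes_inv[OF \<tau>])
  have inv_\<sigma>: "inv \<sigma> = \<tau>" unfolding \<sigma>_def by (rule permutes_inv_inv[OF \<tau>])
  note s = permutes_inv_mem[OF \<sigma>, unfolded inv_\<sigma>]
  have s': "\<sigma> p \<in> {1..n} \<longleftrightarrow> p \<in> {1..n}" for p using permutes_in_image[OF \<sigma>] .
  have less: "\<tau> i < \<tau> j \<longleftrightarrow> prec g i j" if "i \<in> {1..n}" "j \<in> {1..n}" for i j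
    using that rank_less_iff by (simp add: \<tau>_def)
  \<comment> \<open>Read in the order of the ranks, the labels form the weakly decreasing word itself.\<close>
  have lab: "v (\<tau> i) = fst (g i)" if "i \<in> {1..n}" for i
  proof -
    have "fst (g (\<sigma> (\<tau> i))) = v (\<tau> i)"
    proof (rule antitone_unique)
      fix p q assume pq: "1 \<le> p" "p \<le> q" "q \<le> n"
      show "fst (g (\<sigma> q)) \<le> fst (g (\<sigma> p))"
      proof (cases "p = q")
        case False
        then have "prec g (\<sigma> p) (\<sigma> q)"
          using less[of "\<sigma> p" "\<sigma> q"] pq s'[of p] s'[of q] by (auto simp: s)
        then show ?thesis by (auto simp: prec_def)
      qed simp
    next
      have "image_mset \<sigma> (mset_set {1..n}) = mset_set {1..n}"
        using \<sigma> by (subst image_mset_mset_set)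
          (auto simp: permutes_image intro: permutes_inj_on)
      then show "image_mset (\<lambda>p. fst (g (\<sigma> p))) (mset_set {1..n}) = content"
        using content by (metis (no_types, lifting) comp_apply image_mset_cong multiset.map_comp)
    next
      show "\<tau> i \<in> {1..n}" using that s(1) by auto
    qed
    then show ?thesis by (simp add: s)
  qed
  have start: "card {i\<in>{1..n}. b < fst (g i)} = block_start b" for b
    using card_filter_eq_size[of "{1..n}" "\<lambda>c. b < c" "\<lambda>i. fst (g i)"]
    unfolding content block_start_def by simp
  have endd: "card {i\<in>{1..n}. b \<le> fst (g i)} = block_end b" for b
    using card_filter_eq_size[of "{1..n}" "\<lambda>c. b \<le> c" "\<lambda>i. fst (g i)"]
    unfolding content block_end_def by simp
  have bar: "snd (g i) \<longleftrightarrow> \<tau> i < i" if i: "i \<in> {1..n}" for i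
  proof -
    have ti: "\<tau> i \<in> {1..n}" using i s(1) by auto
    have adm_i: "admissible i (g i)" using adm[OF i] .
    let ?c = "fst (g i)"
    have tau: "\<tau> i = Suc (card {j\<in>{1..n}. prec g j i})" using i by (simp add: \<tau>_def rank_def)
    show ?thesis
    proof (cases "?c = v i")
      case False
      then show ?thesis using adm_i lab[OF i] antitone[of i "\<tau> i"] antitone[of "\<tau> i" i] i ti
        by (cases "\<tau> i < i") (auto simp: admissible_def split: if_splits)
    next
      case True
      have sti: "block_start ?c < i" "i \<le> block_end ?c"
        using less_v_iff[OF i, of ?c] le_v_iff[OF i, of ?c] True by auto
      show ?thesis
      proof (cases "snd (g i)")
        case bar: True
        \<comment> \<open>No barred letter of the block stands on its first position.\<close>
        have "{j\<in>{1..n}. prec g j i} \<subseteq> {j\<in>{1..n}. ?c < fst (g j)} \<union> {Suc (block_start ?c)<..<i}"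
        proof
          fix j assume j: "j \<in> {j\<in>{1..n}. prec g j i}"
          then have jn: "j \<in> {1..n}" by auto
          show "j \<in> {j\<in>{1..n}. ?c < fst (g j)} \<union> {Suc (block_start ?c)<..<i}"
          proof (cases "?c < fst (g j)")
            case False
            then have j': "fst (g j) = ?c" "snd (g j)" "j < i" using j bar by (auto simp: prec_def)
            then have "v j \<le> ?c" "v j = ?c \<Longrightarrow> j \<noteq> Suc (block_start ?c)"
              using adm[OF jn] by (auto simp: admissible_def)
            then have "block_start ?c < j" "j \<noteq> Suc (block_start ?c)"
              using less_v_iff[OF jn, of ?c] le_v_iff[OF jn, of ?c] sti j' by auto
            then show ?thesis using j' by auto
          qed (use jn in auto)
        qed
        then have "card {j\<in>{1..n}. prec g j i} \<le> card ({j\<in>{1..n}. ?c < fst (g j)} \<union> {Suc (block_start ?c)<..<i})"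
          by (intro card_mono) auto
        also have "\<dots> \<le> block_start ?c + (i - Suc (Suc (block_start ?c)))"
          using card_Un_le[of "{j\<in>{1..n}. ?c < fst (g j)}" "{Suc (block_start ?c)<..<i}"]
          unfolding start by simp
        finally have "\<tau> i \<le> Suc (block_start ?c + (i - Suc (Suc (block_start ?c))))" using tau by simp
        moreover have "i \<noteq> Suc (block_start ?c)" using adm_i bar True by (auto simp: admissible_def)
        ultimately show ?thesis using bar sti by auto
      next
        case plain: False
        \<comment> \<open>Unbarred letters of the block do not stand beyond its last position.\<close>
        have "{j\<in>{1..n}. ?c \<le> fst (g j)} \<subseteq> insert i ({j\<in>{1..n}. prec g j i} \<union> {i<..block_end ?c})"
        proof
          fix j assume j: "j \<in> {j\<in>{1..n}. ?c \<le> fst (g j)}"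
          then have jn: "j \<in> {1..n}" by auto
          show "j \<in> insert i ({j\<in>{1..n}. prec g j i} \<union> {i<..block_end ?c})"
          proof (cases "prec g j i \<or> j = i")
            case False
            then have j': "fst (g j) = ?c" "\<not> snd (g j)" "i < j" using j plain by (auto simp: prec_def)
            then have "?c \<le> v j" using adm[OF jn] by (auto simp: admissible_def)
            then have "j \<le> block_end ?c" using le_v_iff[OF jn, of ?c] by auto
            then show ?thesis using j' by auto
          qed (use jn in auto)
        qed
        then have "block_end ?c \<le> card (insert i ({j\<in>{1..n}. prec g j i} \<union> {i<..block_end ?c}))"
          unfolding endd[symmetric] by (intro card_mono) auto
        also have "\<dots> \<le> Suc (card ({j\<in>{1..n}. prec g j i} \<union> {i<..block_end ?c}))"
          by (simp add: card_insert_if)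
        also have "\<dots> \<le> Suc (card {j\<in>{1..n}. prec g j i} + (block_end ?c - i))"
          using card_Un_le[of "{j\<in>{1..n}. prec g j i}" "{i<..block_end ?c}"] by simp
        finally have "i \<le> \<tau> i" using tau sti by simp
        then show ?thesis using plain by simp
      qed
    qed
  qed
  have "compatible \<sigma>"
    unfolding compatible_iff
  proof (intro conjI allI impI \<sigma>)
    fix p q assume pq: "1 \<le> p" "p < q" "q \<le> n" "v p = v q"
    have m: "\<sigma> p \<in> {1..n}" "\<sigma> q \<in> {1..n}" using pq s'[of p] s'[of q] by auto
    have "prec g (\<sigma> p) (\<sigma> q)" using less[OF m] pq by (simp add: s)
    then show "before \<sigma> p q"
      using lab[OF m(1)] lab[OF m(2)] bar[OF m(1)] bar[OF m(2)] pq
      by (auto simp: prec_def before_def s)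
  qed
  moreover have "code \<sigma> = g"
  proof
    fix i show "code \<sigma> i = g i"
      using lab[of i] bar[of i] ext
      by (cases "i \<in> {1..n}") (auto simp: code_def inv_\<sigma> extensional_def prod_eq_iff)
  qed
  ultimately show thesis by (rule that)
qed

lemma exc_eq_card_code:
  assumes "\<sigma> permutes {1..n}"
  shows "exc n \<sigma> = card {i\<in>{1..n}. snd (code \<sigma> i)}"
proof -
  note s = permutes_inv_mem[OF assms]
  have "{i\<in>{1..n}. snd (code \<sigma> i)} = \<sigma> ` EXC n \<sigma>"
  proof (intro equalityI subsetI)
    fix i assume "i \<in> {i\<in>{1..n}. snd (code \<sigma> i)}"
    then have "inv \<sigma> i \<in> EXC n \<sigma>" using s(1)[of i] by (auto simp: EXC_iff[OF assms] code_def s)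
    then show "i \<in> \<sigma> ` EXC n \<sigma>" using s(2) by (metis imageI)
  next
    fix i assume "i \<in> \<sigma> ` EXC n \<sigma>"
    then obtain p where "i = \<sigma> p" "p \<in> {1..n}" "p < \<sigma> p" by (auto simp: EXC_iff[OF assms])
    then show "i \<in> {i\<in>{1..n}. snd (code \<sigma> i)}"
      using permutes_in_image[OF assms, of p] by (auto simp: code_def s)
  qed
  then show ?thesis
    using card_image[OF permutes_inj_on[OF assms]] by (simp add: exc_def)
qed

definition fixed_labels :: "(nat \<Rightarrow> nat) \<Rightarrow> nat multiset" where
  "fixed_labels \<sigma> = image_mset v (mset_set {i\<in>{1..n}. \<sigma> i = i})"

lemma size_fixed_labels: "size (fixed_labels \<sigma>) = fixed_points n \<sigma>"
  by (simp add: fixed_labels_def fixed_points_def)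

lemma fixed_labels_subset: "fixed_labels \<sigma> \<subseteq># content"
  unfolding fixed_labels_def content_def
  by (intro image_mset_subseteq_mono subset_imp_msubset_mset_set) auto

lemma count_fixed_labels: "count (fixed_labels \<sigma>) b = card {i\<in>{1..n}. \<sigma> i = i \<and> v i = b}"
proof -
  have "count (fixed_labels \<sigma>) b = size (filter_mset (\<lambda>c. c = b) (fixed_labels \<sigma>))"
    by (simp add: filter_eq_replicate_mset)
  also have "\<dots> = card {i \<in> {i\<in>{1..n}. \<sigma> i = i}. v i = b}"
    unfolding fixed_labels_def by (rule card_filter_eq_size[symmetric]) simp
  also have "{i \<in> {i\<in>{1..n}. \<sigma> i = i}. v i = b} = {i\<in>{1..n}. \<sigma> i = i \<and> v i = b}" by auto
  finally show ?thesis .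
qed

text \<open>
The last \<open>count A b\<close> places of each block \<open>b\<close>.
\<close>

definition trailing :: "nat multiset \<Rightarrow> nat \<Rightarrow> bool" where
  "trailing A i \<longleftrightarrow> block_end (v i) - count A (v i) < i"

text \<open>
The conditions on the letter at place \<open>i\<close> if the fixed points are to be exactly the trailing places:
these carry unbarred copies of their own label, and the place just before them (the last place of
the block if there are none) does not.
\<close>

definition allowed :: "nat multiset \<Rightarrow> nat \<Rightarrow> nat \<times> bool \<Rightarrow> bool" where
  "allowed A i x \<longleftrightarrow> (if trailing A i then x = (v i, False)
     else admissible i x \<and> \<not> (x = (v i, False) \<and> i = block_end (v i) - count A (v i)))"

lemma allowed_imp_admissible: "allowed A i x \<Longrightarrow> admissible i x"
  by (auto simp: allowed_def admissible_def split: if_splits)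

lemma mem_block: "i \<in> {1..n} \<Longrightarrow> i \<in> {block_start (v i)<..block_end (v i)}"
  using block_eq[of "v i"] by blast

lemma v_eq_in_block: "j \<in> {block_start b<..block_end b} \<Longrightarrow> j \<in> {1..n} \<and> v j = b"
  using block_eq[of b] by blast

text \<open>
An unbarred copy of the own label at \<open>i\<close> comes from \<open>i\<close> itself or from a later place of the block.
\<close>

lemma inv_plain_code:
  assumes "\<sigma> permutes {1..n}" "i \<in> {1..n}" "code \<sigma> i = (v i, False)"
  shows "inv \<sigma> i \<in> {1..n}" "v (inv \<sigma> i) = v i" "i \<le> inv \<sigma> i"
  using assms permutes_inv_mem[OF assms(1), of i] by (auto simp: code_def)

text \<open>
Fixed points end their block: behind a fixed point \<open>j\<close> there are no excedances and values exceed \<open>j\<close>, so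
the next value is \<open>j + 1\<close>.
\<close>

lemma fixed_upward:
  assumes c: "compatible \<sigma>" and i: "i \<in> {1..n}" "\<sigma> i = i" and j: "i \<le> j" "j \<le> n" "v j = v i"
  shows "\<sigma> j = j"
  using j
proof (induction j)
  case (Suc j)
  show ?case
  proof (cases "i = Suc j")
    case False
    with Suc.prems have ij: "i \<le> j" "j < n" by auto
    then have "v j = v i" using antitone[of i j] antitone[of j "Suc j"] i Suc.prems by auto
    with ij Suc have "\<sigma> j = j" by auto
    moreover have "before \<sigma> j (Suc j)"
      using c ij i Suc.prems \<open>v j = v i\<close> unfolding compatible_iff by auto
    ultimately show ?thesis by (auto simp: before_def)
  qed (use i in simp)
qed (use i in simp)

text \<open>
In each block the fixed points are the last few places, so they are known once their number is. A
place with an unbarred copy of its own label comes from itself or from a later place of the block;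
if all later places are fixed, only the first possibility is left. This shows both that the trailing
places of an allowed word are fixed and that the place before the fixed points is not of this kind.
\<close>

lemma fixed_labels_eq_iff:
  assumes c: "compatible \<sigma>" and A: "A \<subseteq># content"
  shows "fixed_labels \<sigma> = A \<longleftrightarrow> (\<forall>i\<in>{1..n}. allowed A i (code \<sigma> i))"
proof
  have \<sigma>: "\<sigma> permutes {1..n}" using c by (simp add: compatible_def)
  note s = permutes_inv_mem[OF \<sigma>]
  have code_fixed: "code \<sigma> i = (v i, False)" if "i \<in> {1..n}" "\<sigma> i = i" for i
    using that s(3)[of i] by (simp add: code_def)
  {
    assume eq: "fixed_labels \<sigma> = A"
    have fixed_iff: "\<sigma> i = i \<longleftrightarrow> trailing A i" if i: "i \<in> {1..n}" for i
    proof -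
      let ?S = "{j\<in>{1..n}. \<sigma> j = j \<and> v j = v i}"
      have "i \<in> ?S \<longleftrightarrow> block_end (v i) - card ?S < i"
      proof (rule up_closed_iff)
        show "?S \<subseteq> {block_start (v i)<..block_end (v i)}" using mem_block by force
        show "i \<in> {block_start (v i)<..block_end (v i)}" using mem_block[OF i] .
        fix k j assume k: "k \<in> ?S" "k \<le> j" "j \<le> block_end (v i)"
        then have "j \<in> {block_start (v i)<..block_end (v i)}" using mem_block[of k] by auto
        then have "j \<in> {1..n}" "v j = v i" using v_eq_in_block by auto
        then show "j \<in> ?S" using k fixed_upward[OF c, of k j] by auto
      qed
      then show ?thesis using i by (simp add: trailing_def eq[symmetric] count_fixed_labels)
    qed
    show "\<forall>i\<in>{1..n}. allowed A i (code \<sigma> i)"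
    proof
      fix i assume i: "i \<in> {1..n}"
      have "\<not> (code \<sigma> i = (v i, False) \<and> i = block_end (v i) - count A (v i))" if "\<not> trailing A i"
      proof
        assume *: "code \<sigma> i = (v i, False) \<and> i = block_end (v i) - count A (v i)"
        then have q: "inv \<sigma> i \<in> {1..n}" "v (inv \<sigma> i) = v i" "i \<le> inv \<sigma> i"
          using inv_plain_code[OF \<sigma> i] by auto
        have "inv \<sigma> i \<noteq> i" using fixed_iff[OF i] that s(2)[of i] by metis
        then have "trailing A (inv \<sigma> i)" using q * by (auto simp: trailing_def)
        then have "\<sigma> (inv \<sigma> i) = inv \<sigma> i" using fixed_iff[OF q(1)] by simp
        then show False using s(2)[of i] \<open>inv \<sigma> i \<noteq> i\<close> by simp
      qed
      then show "allowed A i (code \<sigma> i)"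
        using fixed_iff[OF i] code_fixed[OF i] code_admissible[OF c i] by (auto simp: allowed_def)
    qed
  }
  {
    assume al: "\<forall>i\<in>{1..n}. allowed A i (code \<sigma> i)"
    have trailing_fixed: "\<sigma> i = i" if "i \<in> {1..n}" "trailing A i" for i
      using that
    proof (induction "n - i" arbitrary: i rule: less_induct)
      case less
      then have "code \<sigma> i = (v i, False)" using al by (auto simp: allowed_def)
      then have q: "inv \<sigma> i \<in> {1..n}" "v (inv \<sigma> i) = v i" "i \<le> inv \<sigma> i"
        using inv_plain_code[OF \<sigma>] less.prems by auto
      show ?case
      proof (cases "inv \<sigma> i = i")
        case True
        then show ?thesis using s(2)[of i] by simp
      next
        case False
        have "\<sigma> (inv \<sigma> i) = inv \<sigma> i"
          by (rule less.hyps) (use q False less.prems in \<open>auto simp: trailing_def\<close>)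
        then show ?thesis using s(2)[of i] by simp
      qed
    qed
    have fixed_trailing: "trailing A i" if i: "i \<in> {1..n}" "\<sigma> i = i" for i
    proof (rule ccontr)
      assume nt: "\<not> trailing A i"
      let ?j = "block_end (v i) - count A (v i)"
      have "?j \<in> {block_start (v i)<..block_end (v i)}"
        using nt mem_block[OF i(1)] by (auto simp: trailing_def)
      then have j: "?j \<in> {1..n}" "v ?j = v i" using v_eq_in_block[of ?j "v i"] by blast+
      then have "\<sigma> ?j = ?j"
        using fixed_upward[OF c i, of ?j] nt by (auto simp: trailing_def)
      then have "code \<sigma> ?j = (v ?j, False)" using code_fixed j by blast
      moreover have "\<not> trailing A ?j" using j by (simp add: trailing_def)
      moreover have "allowed A ?j (code \<sigma> ?j)" using al j(1) by blast
      ultimately show False by (simp add: allowed_def j(2))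
    qed
    show "fixed_labels \<sigma> = A"
    proof (rule multiset_eqI)
      fix b
      have le: "count A b \<le> count content b" using A by (simp add: subseteq_mset_def)
      have "{i\<in>{1..n}. \<sigma> i = i \<and> v i = b} = {i \<in> {i\<in>{1..n}. v i = b}. trailing A i}"
        using trailing_fixed fixed_trailing by auto
      also have "\<dots> = {i \<in> {i\<in>{1..n}. v i = b}. block_end b - count A b < i}"
        by (auto simp: trailing_def)
      also have "\<dots> = {block_end b - count A b<..block_end b}"
        unfolding block_eq using le by (auto simp: block_end_eq)
      finally show "count (fixed_labels \<sigma>) b = count A b"
        using le by (simp add: count_fixed_labels block_end_eq)
    qed
  }
qed

definition words :: "nat multiset \<Rightarrow> (nat \<Rightarrow> nat \<times> bool) set" where
  "words A = {g \<in> (\<Pi>\<^sub>E i\<in>{1..n}. {x \<in> set_mset content \<times> UNIV. allowed A i x}).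
     image_mset (\<lambda>i. fst (g i)) (mset_set {1..n}) = content}"

lemma bij_betw_code:
  assumes A: "A \<subseteq># content"
  shows "bij_betw code {\<sigma>. compatible \<sigma> \<and> fixed_labels \<sigma> = A} (words A)"
  unfolding bij_betw_def
proof (intro conjI equalityI subsetI)
  show "inj_on code {\<sigma>. compatible \<sigma> \<and> fixed_labels \<sigma> = A}"
    by (rule inj_on_subset[OF inj_on_code]) auto
next
  fix g assume "g \<in> code ` {\<sigma>. compatible \<sigma> \<and> fixed_labels \<sigma> = A}"
  then obtain \<sigma> where s: "g = code \<sigma>" "compatible \<sigma>" "fixed_labels \<sigma> = A" by auto
  have content: "image_mset (\<lambda>i. fst (g i)) (mset_set {1..n}) = content"
    using code_content s by (simp add: compatible_def)
  moreover have "fst (g i) \<in># content" if "i \<in> {1..n}" for i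
    unfolding content[symmetric] using that by auto
  ultimately show "g \<in> words A"
    using s fixed_labels_eq_iff[OF s(2) A] by (auto simp: words_def code_def mem_Times_iff)
next
  fix g assume g: "g \<in> words A"
  then have al: "allowed A i (g i)" if "i \<in> {1..n}" for i using that by (auto simp: words_def)
  obtain \<sigma> where s: "compatible \<sigma>" "code \<sigma> = g"
  proof (rule code_surj[of g])
    show "admissible i (g i)" if "i \<in> {1..n}" for i
      using allowed_imp_admissible al that by blast
  qed (use g in \<open>auto simp: words_def PiE_def\<close>)
  then have "fixed_labels \<sigma> = A" using fixed_labels_eq_iff[OF s(1) A] al by simp
  with s show "g \<in> code ` {\<sigma>. compatible \<sigma> \<and> fixed_labels \<sigma> = A}" by auto
qed

lemma card_compatible_eq_card_words:
  assumes "A \<subseteq># content"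
  shows "card {\<sigma>. compatible \<sigma> \<and> fixed_labels \<sigma> = A \<and> exc n \<sigma> = j}
    = card {g \<in> words A. card {i\<in>{1..n}. snd (g i)} = j}"
proof (rule bij_betw_same_card)
  have b: "bij_betw code {\<sigma>. compatible \<sigma> \<and> fixed_labels \<sigma> = A} (words A)"
    by (rule bij_betw_code[OF assms])
  have e: "exc n \<sigma> = card {i\<in>{1..n}. snd (code \<sigma> i)}" if "compatible \<sigma>" for \<sigma>
    using that exc_eq_card_code by (simp add: compatible_def)
  show "bij_betw code {\<sigma>. compatible \<sigma> \<and> fixed_labels \<sigma> = A \<and> exc n \<sigma> = j}
      {g \<in> words A. card {i\<in>{1..n}. snd (g i)} = j}"
    unfolding bij_betw_def
  proof
    show "inj_on code {\<sigma>. compatible \<sigma> \<and> fixed_labels \<sigma> = A \<and> exc n \<sigma> = j}"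
      by (rule inj_on_subset[OF inj_on_code]) auto
    have img: "code ` {\<sigma>. compatible \<sigma> \<and> fixed_labels \<sigma> = A} = words A"
      using b by (simp add: bij_betw_def)
    have "{g \<in> words A. card {i\<in>{1..n}. snd (g i)} = j}
        = code ` {\<sigma> \<in> {\<sigma>. compatible \<sigma> \<and> fixed_labels \<sigma> = A}. card {i\<in>{1..n}. snd (code \<sigma> i)} = j}"
      unfolding img[symmetric] by (rule Compr_image_eq)
    also have "{\<sigma> \<in> {\<sigma>. compatible \<sigma> \<and> fixed_labels \<sigma> = A}. card {i\<in>{1..n}. snd (code \<sigma> i)} = j}
        = {\<sigma>. compatible \<sigma> \<and> fixed_labels \<sigma> = A \<and> exc n \<sigma> = j}"
    proof (rule Collect_cong)
      fix \<sigma>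
      have "card {i\<in>{1..n}. snd (code \<sigma> i)} = exc n \<sigma>" if "compatible \<sigma>"
        by (rule e[OF that, symmetric])
      then show "(\<sigma> \<in> {\<sigma>. compatible \<sigma> \<and> fixed_labels \<sigma> = A} \<and> card {i\<in>{1..n}. snd (code \<sigma> i)} = j)
          = (compatible \<sigma> \<and> fixed_labels \<sigma> = A \<and> exc n \<sigma> = j)"
        by (cases "compatible \<sigma>") (simp_all only: mem_Collect_eq simp_thms)
    qed
    finally show "code ` {\<sigma>. compatible \<sigma> \<and> fixed_labels \<sigma> = A \<and> exc n \<sigma> = j}
        = {g \<in> words A. card {i\<in>{1..n}. snd (g i)} = j}" ..
  qed
qed

end

section \<open>Counting words with linear forms\<close>

lemma finite_set_nat_bool: "finite (set_mset M \<times> (UNIV :: bool set))"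
  by simp

context block_word
begin

definition letter_form :: "'a::comm_ring_1 \<Rightarrow> nat multiset \<Rightarrow> nat \<Rightarrow> 'a mpseries" where
  "letter_form t A i = (\<Sum>x | x \<in> set_mset content \<times> UNIV \<and> allowed A i x.
     mscale (if snd x then t else 1) (mvar (fst x)))"

lemma finite_allowed: "finite {x \<in> set_mset content \<times> (UNIV :: bool set). allowed A i x}"
  by (rule finite_subset[OF _ finite_set_nat_bool[of content]]) auto

lemma finite_words: "finite (words A)"
proof (rule finite_subset)
  show "words A \<subseteq> (\<Pi>\<^sub>E i\<in>{1..n}. {x \<in> set_mset content \<times> UNIV. allowed A i x})"
    by (auto simp: words_def)
  show "finite (\<Pi>\<^sub>E i\<in>{1..n}. {x \<in> set_mset content \<times> (UNIV :: bool set). allowed A i x})"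
    by (intro finite_PiE finite_allowed) simp
qed

text \<open>
Expanding the product chooses one letter for each place.
\<close>

lemma mcoeff_prod_letter_form:
  "mcoeff (\<Prod>i\<in>{1..n}. letter_form t A i) content
     = (\<Sum>g\<in>words A. t ^ card {i\<in>{1..n}. snd (g i)})"
proof -
  let ?G = "\<Pi>\<^sub>E i\<in>{1..n}. {x \<in> set_mset content \<times> UNIV. allowed A i x}"
  have fin: "finite ?G" by (intro finite_PiE finite_allowed) simp
  have eq: "(\<Prod>i\<in>{1..n}. letter_form t A i)
      = (\<Sum>g\<in>?G. \<Prod>i\<in>{1..n}. mscale (if snd (g i) then t else 1) (mvar (fst (g i))))"
    unfolding letter_form_def using finite_allowed by (subst prod_sum_PiE) auto
  have "mcoeff (\<Prod>i\<in>{1..n}. letter_form t A i) content = mcoeff (\<Sum>g\<in>?G. mscale (t ^ card {i\<in>{1..n}. snd (g i)})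
      (mono_series (image_mset (\<lambda>i. fst (g i)) (mset_set {1..n})))) content"
    unfolding eq by (intro arg_cong[of _ _ "\<lambda>f. mcoeff f content"] sum.cong refl)
      (simp add: mscale_prod prod_mvar prod.If_cases Int_def conj_commute)
  also have "\<dots> = (\<Sum>g\<in>?G.
      if image_mset (\<lambda>i. fst (g i)) (mset_set {1..n}) = content then t ^ card {i\<in>{1..n}. snd (g i)} else 0)"
    unfolding mcoeff_sum by (intro sum.cong refl) (auto simp: mono_series_def)
  also have "\<dots> = (\<Sum>g\<in>words A. t ^ card {i\<in>{1..n}. snd (g i)})"
    unfolding words_def by (rule sum.inter_filter[OF fin, symmetric])
  finally show ?thesis .
qed

text \<open>
The sum of all letters allowed at \<open>i\<close>, written with the row form: the barred label is excluded at the
first place of the block and the unbarred one at the last place before the fixed points. A block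
that consists of fixed points has no such places; there, \<open>trailing\<close> takes precedence.
\<close>

definition position_form :: "'a::comm_ring_1 \<Rightarrow> nat multiset \<Rightarrow> nat \<Rightarrow> 'a mpseries" where
  "position_form t A i = (if trailing A i then mvar (v i) else row_form t (v i)
     - mscale (if i = Suc (block_start (v i)) then t else 0) (mvar (v i))
     - mscale (if i = block_end (v i) - count A (v i) then 1 else 0) (mvar (v i)))"

lemma agree_on_letter_form:
  assumes "i \<in> {1..n}"
  shows "agree_on (set_mset content) (position_form t A i) (letter_form t A i)"
proof -
  let ?B = "set_mset content"
  define f where "f = (\<lambda>c. (if allowed A i (c, True) then t else 0) + (if allowed A i (c, False) then 1 else 0))"
  have "position_form t A i = lin_form f"
  proof (rule mpseries_eqI)
    fix M show "mcoeff (position_form t A i) M = mcoeff (lin_form f) M"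
      by (auto simp: position_form_def row_form_def cut_form_def lin_form_def mono_series_def
          mcoeff_simps size_1_iff f_def allowed_def admissible_def)
  qed
  moreover have "agree_on ?B (lin_form f) (\<Sum>c\<in>?B. mscale (f c) (mvar c))"
    by (rule agree_on_lin_form_sum) simp
  moreover have "(\<Sum>c\<in>?B. mscale (f c) (mvar c)) = letter_form t A i"
  proof -
    have "letter_form t A i = (\<Sum>x\<in>?B \<times> UNIV.
        if allowed A i x then mscale (if snd x then t else 1) (mvar (fst x)) else 0)"
      unfolding letter_form_def by (rule sum.inter_filter) simp
    also have "\<dots> = (\<Sum>c\<in>?B. \<Sum>b\<in>UNIV.
        if allowed A i (c, b) then mscale (if b then t else 1) (mvar c) else 0)"
      by (simp add: sum.cartesian_product split_def)
    also have "\<dots> = (\<Sum>c\<in>?B. mscale (f c) (mvar c))"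
      by (intro sum.cong refl) (auto simp: UNIV_bool f_def mscale_add_left add.commute)
    finally show ?thesis ..
  qed
  ultimately show ?thesis by simp
qed

text \<open>
The last \<open>count A b\<close> places of the block contribute one variable each, and the others form a block
without fixed points.
\<close>

lemma prod_position_form_block:
  assumes A: "A \<subseteq># content"
  shows "(\<Prod>i | i \<in> {1..n} \<and> v i = b. position_form t A i)
    = mvar b ^ count A b * derangement_block t b (count content b - count A b)"
proof -
  let ?s = "block_start b"
  define k a where "k = count content b - count A b" and "a = count A b"
  have le: "count A b \<le> count content b" using A by (simp add: subseteq_mset_def)
  then have e: "block_end b = ?s + k + a" by (simp add: block_end_eq k_def a_def)
  define F where "F = (\<lambda>i. if ?s + k < i then mvar b else row_form t b
     - mscale (if i = Suc ?s then t else 0) (mvar b) - mscale (if i = ?s + k then 1 else 0) (mvar b))"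
  have "(\<Prod>i | i \<in> {1..n} \<and> v i = b. position_form t A i) = (\<Prod>i\<in>{?s<..block_end b}. F i)"
    unfolding block_eq[symmetric]
    by (intro prod.cong refl) (auto simp: position_form_def F_def trailing_def e a_def)
  also have "{?s<..block_end b} = {?s<..?s + k} \<union> {?s + k<..?s + k + a}" by (auto simp: e)
  also have "(\<Prod>i\<in>\<dots>. F i) = (\<Prod>i\<in>{?s<..?s + k}. F i) * (\<Prod>i\<in>{?s + k<..?s + k + a}. F i)"
    by (rule prod.union_disjoint) auto
  also have "(\<Prod>i\<in>{?s + k<..?s + k + a}. F i) = mvar b ^ a"
    by (simp add: F_def)
  also have "(\<Prod>i\<in>{?s<..?s + k}. F i) = derangement_block t b k"
  proof -
    consider "k = 0" | "k = 1" | m where "k = Suc (Suc m)" by (metis One_nat_def not0_implies_Suc)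
    then show ?thesis
    proof cases
      case 2
      then have "{?s<..?s + k} = {Suc ?s}" by auto
      then show ?thesis using 2 by (simp add: derangement_block_def F_def cut_form_eq)
    next
      case 3
      have "{?s<..?s + k} = insert (Suc ?s) (insert (?s + k) {Suc ?s<..<?s + k})" using 3 by auto
      then have "(\<Prod>i\<in>{?s<..?s + k}. F i) = F (Suc ?s) * (F (?s + k) * (\<Prod>i\<in>{Suc ?s<..<?s + k}. F i))"
        using 3 by simp
      also have "(\<Prod>i\<in>{Suc ?s<..<?s + k}. F i) = row_form t b ^ m"
      proof -
        have "(\<Prod>i\<in>{Suc ?s<..<?s + k}. F i) = (\<Prod>i\<in>{Suc ?s<..<?s + k}. row_form t b)"
          by (rule prod.cong) (auto simp: F_def)
        then show ?thesis using 3 by simp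
      qed
      also have "F (Suc ?s) = cut_form t (Suc b)" using 3 by (simp add: F_def cut_form_Suc)
      also have "F (?s + k) = cut_form t b" using 3 by (simp add: F_def cut_form_eq)
      finally show ?thesis using 3 by (simp add: derangement_block_def mult_ac)
    qed (simp add: derangement_block_def)
  qed
  finally show ?thesis by (simp add: k_def a_def mult.commute)
qed

lemma sum_words:
  assumes A: "A \<subseteq># content"
  shows "(\<Sum>g\<in>words A. t ^ card {i\<in>{1..n}. snd (g i)}) = derangement_coeff t (content - A)"
proof -
  let ?B = "set_mset content"
  have "(\<Sum>g\<in>words A. t ^ card {i\<in>{1..n}. snd (g i)}) = mcoeff (\<Prod>i\<in>{1..n}. position_form t A i) content"
    unfolding mcoeff_prod_letter_form[symmetric]
    by (rule agree_onD[OF agree_on_sym[OF agree_on_prod[OF agree_on_letter_form]]]) auto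
  also have "(\<Prod>i\<in>{1..n}. position_form t A i)
      = (\<Prod>b\<in>?B. \<Prod>i | i \<in> {1..n} \<and> v i = b. position_form t A i)"
    by (rule prod.group[symmetric]) (auto simp: content_def)
  also have "\<dots> = (\<Prod>b\<in>?B. mvar b ^ count A b) * (\<Prod>b\<in>?B. derangement_block t b (count (content - A) b))"
    by (simp only: prod_position_form_block[OF A] prod.distrib count_diff)
  also have "(\<Prod>b\<in>?B. mvar b ^ count A b) = mono_series A"
    using A by (intro prod_mono_power) (auto dest: mset_subset_eqD)
  also have "mcoeff (mono_series A * (\<Prod>b\<in>?B. derangement_block t b (count (content - A) b))) content
      = derangement_coeff t (content - A)"
  proof -
    have "derangement_coeff t (content - A)
        = mcoeff (\<Prod>b\<in>?B. derangement_block t b (count (content - A) b)) (content - A)"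
      by (rule derangement_coeff_superset) (auto dest: in_diffD)
    then show ?thesis using A by (simp add: mcoeff_mono_mult del: count_diff)
  qed
  finally show ?thesis .
qed

text \<open>
With \<open>t\<close> an indeterminate, the coefficient of \<open>t\<^sup>j\<close> selects the permutations with \<open>j\<close> excedances.
\<close>

lemma card_compatible_fixed_labels:
  assumes A: "A \<subseteq># content"
  shows "of_nat (card {\<sigma>. compatible \<sigma> \<and> fixed_labels \<sigma> = A \<and> exc n \<sigma> = j})
    = coeff (derangement_coeff tvar (content - A)) j"
proof -
  have "coeff (derangement_coeff tvar (content - A)) j
      = (\<Sum>g\<in>words A. if card {i\<in>{1..n}. snd (g i)} = j then 1 else 0)"
    unfolding sum_words[OF A, symmetric] by (simp add: coeff_sum monom_power)
  also have "\<dots> = of_nat (card {g \<in> words A. card {i\<in>{1..n}. snd (g i)} = j})"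
    by (simp add: finite_words sum.inter_filter[symmetric])
  finally show ?thesis using card_compatible_eq_card_words[OF A] by simp
qed

lemma finite_compatible: "finite {\<sigma>. compatible \<sigma>}"
  by (rule finite_subset[OF _ finite_permutations[of "{1..n}"]]) (auto simp: compatible_def)

lemma card_compatible:
  "of_nat (card {\<sigma>. compatible \<sigma> \<and> exc n \<sigma> = j \<and> fixed_points n \<sigma> = k})
    = (\<Sum>A | A \<subseteq># content \<and> size A = k. coeff (derangement_coeff tvar (content - A)) j)"
proof -
  have "{\<sigma>. compatible \<sigma> \<and> exc n \<sigma> = j \<and> fixed_points n \<sigma> = k}
      = (\<Union>A\<in>{A. A \<subseteq># content \<and> size A = k}. {\<sigma>. compatible \<sigma> \<and> fixed_labels \<sigma> = A \<and> exc n \<sigma> = j})"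
    using fixed_labels_subset by (auto simp: size_fixed_labels)
  then have "card {\<sigma>. compatible \<sigma> \<and> exc n \<sigma> = j \<and> fixed_points n \<sigma> = k}
      = (\<Sum>A | A \<subseteq># content \<and> size A = k. card {\<sigma>. compatible \<sigma> \<and> fixed_labels \<sigma> = A \<and> exc n \<sigma> = j})"
    by (simp only:) (rule card_UN_disjoint,
        auto simp: finite_submultisets intro: finite_subset[OF _ finite_compatible])
  then show ?thesis by (simp add: card_compatible_fixed_labels)
qed

end

section \<open>The coefficients of the Eulerian quasisymmetric functions\<close>

lemma mcoeff_fundamental_qsym_wrong_size:
  assumes "size M \<noteq> n"
  shows "mcoeff (fundamental_qsym S n) M = 0"
proof -
  have "{w. length w = n \<and> (\<forall>j\<in>{1..n - 1}. w ! (j - 1) \<ge> w ! j) \<and> (\<forall>j\<in>S. w ! (j - 1) > w ! j) \<and> mset w = M} = {}"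
    using assms size_mset by blast
  then show ?thesis unfolding fundamental_qsym_def by (simp only: mcoeff_Abs card.empty of_nat_0)
qed

text \<open>
The only weakly decreasing sequence with content \<open>M\<close> is the sorted one.
\<close>

lemma mcoeff_fundamental_qsym:
  fixes M :: "nat multiset"
  assumes S: "S \<subseteq> {1..n - 1}"
  defines "w \<equiv> rev (sorted_list_of_multiset M)"
  assumes M: "size M = n"
  shows "mcoeff (fundamental_qsym S n) M = (if \<forall>j\<in>S. w ! (j - 1) > w ! j then 1 else 0)"
proof -
  have mset_w: "mset w = M" and len: "length w = n"
    using M by (auto simp: w_def) (metis mset_sorted_list_of_multiset size_mset)
  have sorted_iff: "(\<forall>j\<in>{1..n - 1}. u ! (j - 1) \<ge> u ! j) \<longleftrightarrow> sorted (rev u)"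
    if "length u = n" for u :: "nat list"
  proof -
    have "sorted (rev u) \<longleftrightarrow> (\<forall>i. Suc i < length u \<longrightarrow> u ! Suc i \<le> u ! i)"
      by (rule sorted_rev_iff_nth_Suc)
    also have "\<dots> \<longleftrightarrow> (\<forall>j\<in>{1..n - 1}. u ! (j - 1) \<ge> u ! j)"
    proof (intro iffI ballI allI impI)
      fix j assume *: "\<forall>i. Suc i < length u \<longrightarrow> u ! Suc i \<le> u ! i" and j: "j \<in> {1..n - 1}"
      show "u ! (j - 1) \<ge> u ! j" using *[rule_format, of "j - 1"] j that by auto
    next
      fix i assume *: "\<forall>j\<in>{1..n - 1}. u ! (j - 1) \<ge> u ! j" and i: "Suc i < length u"
      show "u ! Suc i \<le> u ! i" using *[rule_format, of "Suc i"] i that by auto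
    qed
    finally show ?thesis by simp
  qed
  have uniq: "u = w" if "sorted (rev u)" "mset u = M" for u
  proof -
    have "rev u = sorted_list_of_multiset M"
      using that by (metis mset_rev sort_key_id_if_sorted sorted_list_of_multiset_mset sorted_sort_id)
    then show ?thesis by (simp add: w_def rev_swap)
  qed
  have "{u. length u = n \<and> (\<forall>j\<in>{1..n - 1}. u ! (j - 1) \<ge> u ! j) \<and> (\<forall>j\<in>S. u ! (j - 1) > u ! j) \<and> mset u = M}
     = (if \<forall>j\<in>S. w ! (j - 1) > w ! j then {w} else {})"
    (is "?U = _")
  proof -
    have "u \<in> ?U \<longleftrightarrow> u = w \<and> (\<forall>j\<in>S. w ! (j - 1) > w ! j)" for u
    proof
      assume u: "u \<in> ?U"
      then have "sorted (rev u)" using sorted_iff[of u] by blast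
      then have "u = w" using uniq u by blast
      with u show "u = w \<and> (\<forall>j\<in>S. w ! (j - 1) > w ! j)" by blast
    next
      assume u: "u = w \<and> (\<forall>j\<in>S. w ! (j - 1) > w ! j)"
      have "sorted (rev w)" by (simp add: w_def)
      then show "u \<in> ?U" using u sorted_iff[OF len] mset_w len by blast
    qed
    then show ?thesis by auto
  qed
  then show ?thesis unfolding fundamental_qsym_def by (simp only: mcoeff_Abs) simp
qed

lemma mcoeff_eulerian_Q_fix:
  "mcoeff (eulerian_Q_fix n j k) M = (if size M = n
     then \<Sum>A | A \<subseteq># M \<and> size A = k. coeff (derangement_coeff tvar (M - A)) j else 0)"
proof (cases "size M = n")
  case False
  then show ?thesis
    by (simp add: eulerian_Q_fix_def mcoeff_sum mcoeff_fundamental_qsym_wrong_size)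
next
  case True
  define w where "w = rev (sorted_list_of_multiset M)"
  define v where "v = (\<lambda>i. w ! (i - 1))"
  have mset_w: "mset w = M" and len: "length w = n"
    using True by (auto simp: w_def) (metis mset_sorted_list_of_multiset size_mset)
  have "sorted (rev w)" by (simp add: w_def)
  then interpret block_word n v
    by unfold_locales (auto simp: v_def len intro: sorted_rev_nth_mono)
  have content: "content = M"
  proof -
    have "content = image_mset (\<lambda>i. w ! i) (image_mset (\<lambda>i. i - 1) (mset_set {1..n}))"
      unfolding content_def by (simp add: v_def multiset.map_comp o_def)
    also have "image_mset (\<lambda>i. i - 1) (mset_set {1..n}) = mset_set {0..<n}"
    proof -
      have "(\<lambda>i. i - 1) ` {1..n} = {0..<n}"
        by (force simp: image_iff Bex_def intro: exI[of _ "Suc _"])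
      then show ?thesis by (subst image_mset_mset_set) (auto simp: inj_on_def)
    qed
    also have "image_mset (\<lambda>i. w ! i) (mset_set {0..<n}) = mset w"
      by (metis len map_nth mset_map mset_upt)
    finally show ?thesis by (simp add: mset_w)
  qed
  have compat: "(\<forall>i\<in>DEX n \<sigma>. w ! (i - 1) > w ! i) \<longleftrightarrow> compatible \<sigma>" if "\<sigma> permutes {1..n}" for \<sigma>
    unfolding compatible_def using that by (auto simp: v_def)
  have "DEX n \<sigma> \<subseteq> {1..n - 1}" for \<sigma> by (auto simp: DEX_def)
  then have coeff_F: "mcoeff (fundamental_qsym (DEX n \<sigma>) n) M = (if compatible \<sigma> then 1 else 0)"
    if "\<sigma> permutes {1..n}" for \<sigma>
    unfolding compat[OF that, symmetric] w_def by (rule mcoeff_fundamental_qsym) (rule True)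
  have "mcoeff (eulerian_Q_fix n j k) M
      = (\<Sum>\<sigma> | \<sigma> permutes {1..n} \<and> exc n \<sigma> = j \<and> fixed_points n \<sigma> = k. if compatible \<sigma> then 1 else 0)"
    unfolding eulerian_Q_fix_def mcoeff_sum
    by (intro sum.cong refl) (simp only: mem_Collect_eq coeff_F)
  also have "\<dots> = of_nat (card {\<sigma> \<in> {\<sigma>. \<sigma> permutes {1..n} \<and> exc n \<sigma> = j \<and> fixed_points n \<sigma> = k}. compatible \<sigma>})"
    by (subst sum.inter_filter[symmetric])
      (auto intro: finite_subset[OF _ finite_permutations[of "{1..n}"]])
  also have "{\<sigma> \<in> {\<sigma>. \<sigma> permutes {1..n} \<and> exc n \<sigma> = j \<and> fixed_points n \<sigma> = k}. compatible \<sigma>}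
      = {\<sigma>. compatible \<sigma> \<and> exc n \<sigma> = j \<and> fixed_points n \<sigma> = k}"
    by (auto simp: compatible_def)
  finally show ?thesis using True by (simp add: card_compatible content)
qed

lemma eulerian_Q_fix_eq:
  "eulerian_Q_fix n j k = (if k \<le> n then complete_h k * coeff (derangement_poly (n - k)) j else 0)"
proof (rule mpseries_eqI)
  fix M
  show "mcoeff (eulerian_Q_fix n j k) M
    = mcoeff (if k \<le> n then complete_h k * coeff (derangement_poly (n - k)) j else 0) M"
  proof (cases "k \<le> n")
    case False
    then have "{A. A \<subseteq># M \<and> size A = k} = {}" if "size M = n"
      using that size_mset_mono by fastforce
    then show ?thesis using False by (auto simp: mcoeff_eulerian_Q_fix mcoeff_simps(1) intro!: sum.neutral)
  next
    case True
    have "mcoeff (complete_h k * coeff (derangement_poly (n - k)) j) M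
        = (\<Sum>A | A \<subseteq># M \<and> size A = k. if size M = n then coeff (derangement_coeff tvar (M - A)) j else 0)"
      unfolding mcoeff_complete_h_mult mcoeff_derangement_poly
    proof (intro sum.cong refl)
      fix A assume A: "A \<in> {A. A \<subseteq># M \<and> size A = k}"
      then have "size (M - A) = n - k \<longleftrightarrow> size M = n"
        using True size_mset_mono[of A M] by (auto simp: size_Diff_submset)
      then show "(if size (M - A) = n - k then coeff (derangement_coeff tvar (M - A)) j else 0)
          = (if size M = n then coeff (derangement_coeff tvar (M - A)) j else 0)" by simp
    qed
    then show ?thesis using True by (simp add: mcoeff_eulerian_Q_fix)
  qed
qed

lemma eulerian_Q_eq_sum: "eulerian_Q n j = (\<Sum>k\<le>n. eulerian_Q_fix n j k)"
proof -
  let ?S = "{\<sigma>. \<sigma> permutes {1..n} \<and> exc n \<sigma> = j}"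
  have "finite {\<sigma>. \<sigma> permutes {1..n}}" by (rule finite_permutations) simp
  then have fin: "finite ?S" by (rule rev_finite_subset) auto
  have le: "fixed_points n \<sigma> \<le> n" for \<sigma>
    unfolding fixed_points_def by (rule order_trans[OF card_mono[of "{1..n}"]]) auto
  have "eulerian_Q n j = (\<Sum>k\<le>n. \<Sum>\<sigma> | \<sigma> \<in> ?S \<and> fixed_points n \<sigma> = k. fundamental_qsym (DEX n \<sigma>) n)"
    unfolding eulerian_Q_def by (rule sum.group[symmetric]) (use fin le in auto)
  then show ?thesis by (simp add: eulerian_Q_fix_def conj_assoc)
qed

lemma exc_le: "exc n \<sigma> \<le> n - 1"
proof -
  have "card (EXC n \<sigma>) \<le> card {1..n - 1}" by (rule card_mono) (auto simp: EXC_def)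
  then show ?thesis by (simp add: exc_def)
qed

lemma coeff_sum_monom_upto: "coeff (\<Sum>j = 0..m. monom (f j) j) i = (if i \<le> m then f i else 0)"
  by (simp add: coeff_sum)

lemma coeff_eulerian_fix_poly: "n \<ge> 1 \<Longrightarrow> coeff (eulerian_fix_poly n k) j = eulerian_Q_fix n j k"
proof -
  assume "n \<ge> 1"
  have "{\<sigma>. \<sigma> permutes {1..n} \<and> exc n \<sigma> = j \<and> fixed_points n \<sigma> = k} = {}" if "\<not> j \<le> n - 1"
    using that exc_le[of n] by auto
  then show ?thesis
    unfolding eulerian_fix_poly_def coeff_sum_monom_upto by (auto simp: eulerian_Q_fix_def intro!: sum.neutral)
qed

lemma eulerian_fix_poly_eq:
  assumes "n \<ge> 1"
  shows "eulerian_fix_poly n k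
    = (if k \<le> n then smult (complete_h k) (derangement_poly (n - k)) else 0)"
  by (rule poly_eqI) (simp add: coeff_eulerian_fix_poly[OF assms] eulerian_Q_fix_eq)

text \<open>
Exponents above \<open>n - 1\<close> do not occur in the polynomials with prescribed number of fixed points, so
these may be summed as a whole.
\<close>

lemma eulerian_poly_eq:
  assumes "n \<ge> 1"
  shows "eulerian_poly n = (\<Sum>k\<le>n. smult (complete_h k) (derangement_poly (n - k)))"
proof -
  have "coeff (eulerian_poly n) j = coeff (\<Sum>k\<le>n. eulerian_fix_poly n k) j" for j
  proof (cases "j \<le> n - 1")
    case True
    then show ?thesis
      unfolding eulerian_poly_def coeff_sum_monom_upto
      by (simp add: coeff_sum coeff_eulerian_fix_poly[OF assms] eulerian_Q_eq_sum)
  next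
    case False
    then show ?thesis
      unfolding eulerian_poly_def eulerian_fix_poly_def coeff_sum coeff_sum_monom_upto by simp
  qed
  then show ?thesis
    by (intro poly_eqI) (simp add: eulerian_fix_poly_eq[OF assms])
qed

theorem theorem5p1:
  fixes n :: nat
  assumes "n \<ge> 1"
  shows
    "(\<forall>j k. symmetric_function (eulerian_Q_fix n j k) \<and> h_positive (eulerian_Q_fix n j k) \<and>
            symmetric_function (eulerian_Q n j) \<and> h_positive (eulerian_Q n j)) \<and>
     (\<forall>k. eulerian_fix_poly n k \<noteq> 0 \<longrightarrow>
            t_symmetric (eulerian_fix_poly n k) \<and> t_unimodal h_le (eulerian_fix_poly n k) \<and>
            center_of_symmetry (eulerian_fix_poly n k) = (of_nat n - of_nat k) / 2) \<and>
     (t_symmetric (eulerian_poly n) \<and> t_unimodal h_le (eulerian_poly n) \<and>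
      center_of_symmetry (eulerian_poly n) = (of_nat n - 1) / 2)"
proof (intro conjI allI impI)
  have fix_pos: "h_positive (eulerian_Q_fix n j k)" for j k
    using h_unimodal_h_positive[OF h_unimodal_derangement_poly]
    by (simp add: eulerian_Q_fix_eq h_positive_complete_h_mult)
  then have pos: "h_positive (eulerian_Q n j)" for j
    by (simp add: eulerian_Q_eq_sum h_positive_sum)
  show "h_positive (eulerian_Q_fix n j k)" "symmetric_function (eulerian_Q_fix n j k)"
    "h_positive (eulerian_Q n j)" "symmetric_function (eulerian_Q n j)" for j k
    using fix_pos pos h_positive_imp_symmetric by auto
next
  fix k assume nz: "eulerian_fix_poly n k \<noteq> 0"
  then have k: "k \<le> n" using eulerian_fix_poly_eq[OF assms] by metis
  then have "h_unimodal (int (n - k)) (eulerian_fix_poly n k)"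
    by (simp only: eulerian_fix_poly_eq[OF assms] if_True h_unimodal_smult h_unimodal_derangement_poly)
  from h_unimodal_imp[OF this nz] k
  show "t_symmetric (eulerian_fix_poly n k)" "t_unimodal h_le (eulerian_fix_poly n k)"
    "center_of_symmetry (eulerian_fix_poly n k) = (of_nat n - of_nat k) / 2"
    by (simp_all add: of_nat_diff)
next
  have "h_unimodal (int n - 1) (eulerian_poly n)"
    using h_unimodal_full[of n] assms by (simp add: eulerian_poly_eq)
  moreover have "eulerian_poly n \<noteq> 0"
    using coeff_full_0_neq_0[of n] assms by (auto simp: eulerian_poly_eq)
  ultimately show "t_symmetric (eulerian_poly n)" "t_unimodal h_le (eulerian_poly n)"
    "center_of_symmetry (eulerian_poly n) = (of_nat n - 1) / 2"
    using h_unimodal_imp by (simp_all del: of_nat_diff)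
qed

end
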